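(* Let $N \cong \mathbb{Z}^n$ be a lattice, let $\Sigma$ be a complete fan in $N_{\mathbb{R}} = N \otimes_{\mathbb{Z}} \mathbb{R}$, let $\Sigma(1)$ be the set of primitive generators in $N$ of the 1-dimensional cones of $\Sigma$, and let $X = X(\Sigma)$ be the corresponding toric variety. If $\Sigma(1)$ is binet, then $X$ is diagonally split at $q$ for all odd integers $q \geq 3$.
   Context: Binet: an integer matrix is binet if the sum of the absolute values of the entries in each column is at most $2$. $\Sigma(1)$ is binet if there is a choice of coordinates $N\cong\mathbb{Z}^n$ such that the matrix whose columns are the vectors in $\Sigma(1)$ is binet. Diagonal splittings: let $X$ be a toric variety (over a field) given by a complete fan $\Sigma$. For an integer $q\ge 2$, multiplication by $q$ on $N_{\mathbb{R}}$ preserves $\Sigma$ and induces a morphism $F\colon X\to X$. A splitting of $X$ at $q$ is an $\mathcal{O}_X$-module map $\pi\colon F_*\mathcal{O}_X\to\mathcal{O}_X$ whose composition with the natural map $\mathcal{O}_X\to F_*\mathcal{O}_X$ is the identity. It is compatible with a subvariety $Z\subset X$ with ideal sheaf $I_Z$ if $\pi(F_*I_Z)\subset I_Z$. The toric variety $X$ is diagonally split at $q$ if there is a splitting at $q$ of the toric variety $X\times X$ compatible with the diagonal $\Delta\subset X\times X$. Recalled known characterization (from earlier work of Payne): with $M=\operatorname{Hom}(N,\mathbb{Z})$ and $M_{\mathbb{R}}=M\otimes_{\mathbb{Z}}\mathbb{R}$, $X$ is diagonally split at $q\ge 2$ if and only if the open polytope $\mathbb{F}_\Sigma=\{u\in M_{\mathbb{R}}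 : |\langle u,v\rangle|<1 \text{ for all } v\in\Sigma(1)\}$ contains a representative of every class in $\frac{1}{q}M/M$. *)

theory Defs
  imports
    "HOL-Analysis.Analysis"
    "HOL-Library.Poly_Mapping"
    "HOL-Computational_Algebra.Fraction_Field"
    "HOL-Algebra.Algebraic_Closure_Type"
begin

section \<open>Lattices, cones and fans\<close>

text \<open>
  The lattice is \<open>N = int ^ 'i\<close> inside \<open>N\<^sub>\<real> = real ^ 'i\<close>, and
  \<open>M = Hom(N, \<int>)\<close> is \<open>'i \<Rightarrow>\<^sub>0 int\<close> through the standard pairing.
  This type is used for \<open>M\<close>, rather than \<open>int ^ 'i\<close>, because a linear order on \<open>'i\<close> makes it
  a linearly ordered group, so that the group algebra \<open>k[M]\<close> is an instance of class \<open>idom\<close>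
  and has a \<open>fract\<close> type.  The order plays no other role.
\<close>

definition real_vec :: "int ^ 'i \<Rightarrow> real ^ 'i" where
  "real_vec v = (\<chi> i. real_of_int (v $ i))"

definition pairing :: "('i::finite \<Rightarrow>\<^sub>0 int) \<Rightarrow> real ^ 'i \<Rightarrow> real" where
  "pairing u x = (\<Sum>i\<in>UNIV. real_of_int (Poly_Mapping.lookup u i) * x $ i)"

definition rational_polyhedral_cone :: "(real ^ 'i::finite) set \<Rightarrow> bool" where
  "rational_polyhedral_cone \<sigma> \<longleftrightarrow> (\<exists>G. finite G \<and> \<sigma> = convex_cone hull (real_vec ` G))"

definition strongly_convex :: "(real ^ 'i::finite) set \<Rightarrow> bool" where
  "strongly_convex \<sigma> \<longleftrightarrow> \<sigma> \<inter> uminus ` \<sigma> = {0}"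

text \<open>The library's \<open>face_of\<close> admits the empty face, which is not a face of a cone.\<close>

definition cone_face :: "(real ^ 'i::finite) set \<Rightarrow> (real ^ 'i) set \<Rightarrow> bool" where
  "cone_face \<tau> \<sigma> \<longleftrightarrow> \<tau> face_of \<sigma> \<and> \<tau> \<noteq> {}"

definition fan :: "(real ^ 'i::finite) set set \<Rightarrow> bool" where
  "fan \<Sigma> \<longleftrightarrow> finite \<Sigma>
     \<and> (\<forall>\<sigma>\<in>\<Sigma>. rational_polyhedral_cone \<sigma> \<and> strongly_convex \<sigma>)
     \<and> (\<forall>\<sigma>\<in>\<Sigma>. \<forall>\<tau>. cone_face \<tau> \<sigma> \<longrightarrow> \<tau> \<in> \<Sigma>)
     \<and> (\<forall>\<sigma>\<in>\<Sigma>. \<forall>\<tau>\<in>\<Sigma>. cone_face (\<sigma> \<inter> \<tau>) \<sigma> \<and> cone_face (\<sigma> \<inter> \<tau>) \<tau>)"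

definition complete_fan :: "(real ^ 'i::finite) set set \<Rightarrow> bool" where
  "complete_fan \<Sigma> \<longleftrightarrow> fan \<Sigma> \<and> \<Union>\<Sigma> = UNIV"

definition primitive :: "int ^ 'i \<Rightarrow> bool" where
  "primitive v \<longleftrightarrow> v \<noteq> 0 \<and> (\<forall>m w. v = m *s w \<longrightarrow> \<bar>m\<bar> = 1)"

text \<open>The set \<open>\<Sigma>(1)\<close>.\<close>

definition ray_generators :: "(real ^ 'i::finite) set set \<Rightarrow> (int ^ 'i) set" where
  "ray_generators \<Sigma> = {v. primitive v \<and> convex_cone hull {real_vec v} \<in> \<Sigma>}"

definition product_cone :: "(real ^ 'i::finite) set \<Rightarrow> (real ^ 'j::finite) set \<Rightarrow> (real ^ ('i + 'j)) set" where
  "product_cone \<sigma> \<tau> = {x. (\<chi> i. x $ Inl i) \<in> \<sigma> \<and> (\<chi> j. x $ Inr j) \<in> \<tau>}"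

definition product_fan ::
    "(real ^ 'i::finite) set set \<Rightarrow> (real ^ 'j::finite) set set \<Rightarrow> (real ^ ('i + 'j)) set set" where
  "product_fan \<Sigma> \<Sigma>' = {product_cone \<sigma> \<tau> | \<sigma> \<tau>. \<sigma> \<in> \<Sigma> \<and> \<tau> \<in> \<Sigma>'}"

section \<open>Binet\<close>

text \<open>An integer matrix with rows indexed by \<open>'r\<close> and columns indexed by the set \<open>C\<close>.\<close>

definition binet_matrix :: "('r::finite \<Rightarrow> 'c \<Rightarrow> int) \<Rightarrow> 'c set \<Rightarrow> bool" where
  "binet_matrix A C \<longleftrightarrow> (\<forall>c\<in>C. (\<Sum>r\<in>UNIV. \<bar>A r c\<bar>) \<le> 2)"

text \<open>A choice of coordinates on \<open>N\<close> is a group isomorphism of \<open>N\<close> onto the standard lattice.\<close>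

definition binet :: "(int ^ 'i::finite) set \<Rightarrow> bool" where
  "binet S \<longleftrightarrow> (\<exists>\<phi> :: int ^ 'i \<Rightarrow> int ^ 'i.
     bij \<phi> \<and> (\<forall>v w. \<phi> (v + w) = \<phi> v + \<phi> w) \<and> binet_matrix (\<lambda>r v. \<phi> v $ r) S)"

section \<open>Affine charts\<close>

text \<open>An order on the index type of \<open>N \<times> N\<close>, again only to make \<open>k[M \<times> M]\<close> an integral domain type.\<close>

instantiation sum :: (linorder, linorder) linorder
begin

fun less_eq_sum :: "'a + 'b \<Rightarrow> 'a + 'b \<Rightarrow> bool" where
  "less_eq_sum (Inl a) (Inl b) = (a \<le> b)"
| "less_eq_sum (Inl a) (Inr b) = True"
| "less_eq_sum (Inr a) (Inl b) = False"
| "less_eq_sum (Inr a) (Inr b) = (a \<le> b)"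

definition less_sum :: "'a + 'b \<Rightarrow> 'a + 'b \<Rightarrow> bool" where
  "less_sum x y \<longleftrightarrow> x \<le> y \<and> \<not> y \<le> x"

instance
proof
  fix x y z :: "'a + 'b"
  show "x < y \<longleftrightarrow> x \<le> y \<and> \<not> y \<le> x" by (rule less_sum_def)
  show "x \<le> x" by (cases x) auto
  show "x \<le> z" if "x \<le> y" "y \<le> z" using that by (cases x; cases y; cases z) auto
  show "x = y" if "x \<le> y" "y \<le> x" using that by (cases x; cases y) auto
  show "x \<le> y \<or> y \<le> x" by (cases x; cases y) auto
qed

end

type_synonym ('i, 'k) laurent = "('i \<Rightarrow>\<^sub>0 int) \<Rightarrow>\<^sub>0 'k"
type_synonym ('i, 'k) rational_function = "('i, 'k) laurent fract"
type_synonym ('i, 'k) chart_point = "(real ^ 'i) set \<times> ('i, 'k) laurent set"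
type_synonym ('i, 'k) toric_point = "('i, 'k) chart_point set"

definition dual_monoid :: "(real ^ 'i::finite) set \<Rightarrow> ('i \<Rightarrow>\<^sub>0 int) set" where
  "dual_monoid \<sigma> = {u. \<forall>x\<in>\<sigma>. 0 \<le> pairing u x}"

text \<open>The coordinate ring \<open>k[\<sigma>\<^sup>\<or> \<inter> M]\<close> of the affine chart \<open>U\<^sub>\<sigma>\<close>, as a subring of \<open>k[M]\<close>.\<close>

definition coord_ring :: "(real ^ 'i::{finite,linorder}) set \<Rightarrow> ('i, 'k::field) laurent set" where
  "coord_ring \<sigma> = {f. Poly_Mapping.keys f \<subseteq> dual_monoid \<sigma>}"

definition spec :: "'a::comm_ring_1 set \<Rightarrow> 'a set set" where
  "spec R = {p. primeideal p (ring_of_type_algebra\<lparr>carrier := R\<rparr>)}"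

definition zariski_open :: "'a::comm_ring_1 set \<Rightarrow> 'a set set \<Rightarrow> bool" where
  "zariski_open R V \<longleftrightarrow> (\<exists>E\<subseteq>R. V = {p \<in> spec R. \<not> E \<subseteq> p})"

text \<open>The local ring \<open>R\<^sub>p\<close> and its maximal ideal, inside the field of fractions.\<close>

definition local_ring :: "'a::idom set \<Rightarrow> 'a set \<Rightarrow> 'a fract set" where
  "local_ring R p = {Fract a b | a b. a \<in> R \<and> b \<in> R - p}"

definition local_max_ideal :: "'a::idom set \<Rightarrow> 'a set \<Rightarrow> 'a fract set" where
  "local_max_ideal R p = {Fract a b | a b. a \<in> p \<and> b \<in> R - p}"

section \<open>The toric variety of a fan\<close>

text \<open>
  The points of \<open>X(\<Sigma>)\<close> are those of the scheme: the disjoint union of the spectra of the charts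
  modulo the equivalence relation generated by the open immersions \<open>U\<^sub>\<tau> \<rightarrow> U\<^sub>\<sigma>\<close>
  for \<open>\<tau>\<close> a face of \<open>\<sigma>\<close>, with the quotient topology.
\<close>

definition chart_points ::
    "(real ^ 'i::{finite,linorder}) set set \<Rightarrow> ('i, 'k::field) chart_point set" where
  "chart_points \<Sigma> = (SIGMA \<sigma>:\<Sigma>. spec (coord_ring \<sigma>))"

definition face_gluing ::
    "(real ^ 'i::{finite,linorder}) set set
      \<Rightarrow> (('i, 'k::field) chart_point \<times> ('i, 'k) chart_point) set" where
  "face_gluing \<Sigma> = {((\<tau>, p), (\<sigma>, p \<inter> coord_ring \<sigma>)) | \<tau> \<sigma> p.
     \<tau> \<in> \<Sigma> \<and> \<sigma> \<in> \<Sigma> \<and> cone_face \<tau> \<sigma> \<and> p \<in> spec (coord_ring \<tau>)}"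

definition gluing ::
    "(real ^ 'i::{finite,linorder}) set set
      \<Rightarrow> (('i, 'k::field) chart_point \<times> ('i, 'k) chart_point) set" where
  "gluing \<Sigma> = (face_gluing \<Sigma> \<union> (face_gluing \<Sigma>)\<inverse>)\<^sup>* \<inter> chart_points \<Sigma> \<times> chart_points \<Sigma>"

lemma equiv_gluing: "equiv (chart_points \<Sigma>) (gluing \<Sigma>)"
proof (rule equivI)
  have "sym ((face_gluing \<Sigma> \<union> (face_gluing \<Sigma>)\<inverse>)\<^sup>*)"
    by (intro sym_rtrancl sym_Un_converse)
  then show "sym (gluing \<Sigma>)"
    by (auto simp: gluing_def sym_def)
  show "trans (gluing \<Sigma>)"
    unfolding gluing_def by (rule transI) (blast intro: rtrancl_trans)
qed (auto simp: gluing_def refl_on_def)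

definition toric_points ::
    "(real ^ 'i::{finite,linorder}) set set \<Rightarrow> ('i, 'k::field) toric_point set" where
  "toric_points \<Sigma> = chart_points \<Sigma> // gluing \<Sigma>"

definition point_of ::
    "(real ^ 'i::{finite,linorder}) set set \<Rightarrow> ('i, 'k::field) chart_point \<Rightarrow> ('i, 'k) toric_point" where
  "point_of \<Sigma> c = gluing \<Sigma> `` {c}"

definition toric_open ::
    "(real ^ 'i::{finite,linorder}) set set \<Rightarrow> ('i, 'k::field) toric_point set \<Rightarrow> bool" where
  "toric_open \<Sigma> U \<longleftrightarrow> U \<subseteq> toric_points \<Sigma> \<and>
     (\<forall>\<sigma>\<in>\<Sigma>. zariski_open (coord_ring \<sigma>) {p \<in> spec (coord_ring \<sigma>). point_of \<Sigma> (\<sigma>, p) \<in> U})"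

text \<open>
  Since \<open>X(\<Sigma>)\<close> is integral, its structure sheaf is realised inside the constant sheaf of rational
  functions: a section over a nonempty open \<open>U\<close> is a rational function lying in the local ring of
  every point of \<open>U\<close>, and restriction maps are inclusions.  On the empty set this does not give
  the zero ring, so everything below is required for nonempty open sets only; there is nothing to
  require over the empty set.
\<close>

definition sections ::
    "(real ^ 'i::{finite,linorder}) set set \<Rightarrow> ('i, 'k::field) toric_point set
      \<Rightarrow> ('i, 'k) rational_function set" where
  "sections \<Sigma> U = {f. \<forall>(\<sigma>, p) \<in> chart_points \<Sigma>.
     point_of \<Sigma> (\<sigma>, p) \<in> U \<longrightarrow> f \<in> local_ring (coord_ring \<sigma>) p}"

text \<open>
  Sections over \<open>U\<close> of the ideal sheaf of a closed subset \<open>Z\<close> with its reduced structure: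
  those vanishing at every point of \<open>Z\<close>.
\<close>

definition ideal_sections ::
    "(real ^ 'i::{finite,linorder}) set set \<Rightarrow> ('i, 'k::field) toric_point set
      \<Rightarrow> ('i, 'k) toric_point set \<Rightarrow> ('i, 'k) rational_function set" where
  "ideal_sections \<Sigma> Z U = {f \<in> sections \<Sigma> U. \<forall>(\<sigma>, p) \<in> chart_points \<Sigma>.
     point_of \<Sigma> (\<sigma>, p) \<in> U \<inter> Z \<longrightarrow> f \<in> local_max_ideal (coord_ring \<sigma>) p}"

section \<open>Multiplication by \<open>q\<close> and splittings\<close>

text \<open>The \<open>k\<close>-linear map \<open>k[M] \<rightarrow> k[M']\<close> sending \<open>x\<^sup>u\<close> to \<open>x\<^bsup>\<phi> u\<^esup>\<close>.\<close>

definition monomial_map ::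
    "(('i \<Rightarrow>\<^sub>0 int) \<Rightarrow> ('j \<Rightarrow>\<^sub>0 int)) \<Rightarrow> ('i, 'k::field) laurent \<Rightarrow> ('j, 'k) laurent" where
  "monomial_map \<phi> f = (\<Sum>u\<in>Poly_Mapping.keys f. Poly_Mapping.single (\<phi> u) (Poly_Mapping.lookup f u))"

text \<open>The extension to fraction fields of an injective ring homomorphism.\<close>

definition map_fract :: "('a::idom \<Rightarrow> 'b::idom) \<Rightarrow> 'a fract \<Rightarrow> 'b fract" where
  "map_fract h f = (THE g. \<exists>a b. b \<noteq> 0 \<and> f = Fract a b \<and> g = Fract (h a) (h b))"

definition frob :: "nat \<Rightarrow> ('i, 'k::field) laurent \<Rightarrow> ('i, 'k) laurent" where
  "frob q = monomial_map (Poly_Mapping.map (\<lambda>m. int q * m))"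

text \<open>The morphism \<open>F\<close> on points (in the chart \<open>U\<^sub>\<sigma>\<close> it is the contraction of primes along
  \<open>frob q\<close>), and the comorphism on rational functions.\<close>

definition frob_point ::
    "(real ^ 'i::{finite,linorder}) set set \<Rightarrow> nat \<Rightarrow> ('i, 'k::field) toric_point \<Rightarrow> ('i, 'k) toric_point" where
  "frob_point \<Sigma> q x = (\<Union>(\<sigma>, p)\<in>x. point_of \<Sigma> (\<sigma>, {f \<in> coord_ring \<sigma>. frob q f \<in> p}))"

definition frob_preimage ::
    "(real ^ 'i::{finite,linorder}) set set \<Rightarrow> nat
      \<Rightarrow> ('i, 'k::field) toric_point set \<Rightarrow> ('i, 'k) toric_point set" where
  "frob_preimage \<Sigma> q U = {x \<in> toric_points \<Sigma>. frob_point \<Sigma> q x \<in> U}"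

definition frob_fract :: "nat \<Rightarrow> ('i::linorder, 'k::field) rational_function \<Rightarrow> ('i, 'k) rational_function" where
  "frob_fract q = map_fract (frob q)"

text \<open>
  \<open>\<pi> U\<close> is the component over \<open>U\<close> of a map of sheaves of modules \<open>F\<^sub>*\<O> \<rightarrow> \<O>\<close>, where
  \<open>(F\<^sub>*\<O>)(U) = \<O>(F\<^sup>-\<^sup>1 U)\<close>, on which \<open>\<O>(U)\<close> acts through \<open>frob_fract q\<close>.
\<close>

definition sheaf_module_map ::
    "(real ^ 'i::{finite,linorder}) set set \<Rightarrow> nat
      \<Rightarrow> (('i, 'k::field) toric_point set \<Rightarrow> ('i, 'k) rational_function \<Rightarrow> ('i, 'k) rational_function)
      \<Rightarrow> bool" where
  "sheaf_module_map \<Sigma> q \<pi> \<longleftrightarrow>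
     (\<forall>U. toric_open \<Sigma> U \<and> U \<noteq> {} \<longrightarrow>
        (\<forall>f\<in>sections \<Sigma> (frob_preimage \<Sigma> q U). \<pi> U f \<in> sections \<Sigma> U) \<and>
        (\<forall>f\<in>sections \<Sigma> (frob_preimage \<Sigma> q U). \<forall>g\<in>sections \<Sigma> (frob_preimage \<Sigma> q U).
           \<pi> U (f + g) = \<pi> U f + \<pi> U g) \<and>
        (\<forall>a\<in>sections \<Sigma> U. \<forall>f\<in>sections \<Sigma> (frob_preimage \<Sigma> q U).
           \<pi> U (frob_fract q a * f) = a * \<pi> U f)) \<and>
     (\<forall>U V. toric_open \<Sigma> U \<and> toric_open \<Sigma> V \<and> V \<subseteq> U \<and> V \<noteq> {} \<longrightarrow>
        (\<forall>f\<in>sections \<Sigma> (frob_preimage \<Sigma> q U). \<pi> V f = \<pi> U f))"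

definition splitting ::
    "(real ^ 'i::{finite,linorder}) set set \<Rightarrow> nat
      \<Rightarrow> (('i, 'k::field) toric_point set \<Rightarrow> ('i, 'k) rational_function \<Rightarrow> ('i, 'k) rational_function)
      \<Rightarrow> bool" where
  "splitting \<Sigma> q \<pi> \<longleftrightarrow> sheaf_module_map \<Sigma> q \<pi> \<and>
     (\<forall>U. toric_open \<Sigma> U \<and> U \<noteq> {} \<longrightarrow> (\<forall>a\<in>sections \<Sigma> U. \<pi> U (frob_fract q a) = a))"

definition compatible_with ::
    "(real ^ 'i::{finite,linorder}) set set \<Rightarrow> nat
      \<Rightarrow> (('i, 'k::field) toric_point set \<Rightarrow> ('i, 'k) rational_function \<Rightarrow> ('i, 'k) rational_function)
      \<Rightarrow> ('i, 'k) toric_point set \<Rightarrow> bool" where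
  "compatible_with \<Sigma> q \<pi> Z \<longleftrightarrow>
     (\<forall>U. toric_open \<Sigma> U \<and> U \<noteq> {} \<longrightarrow>
        \<pi> U ` ideal_sections \<Sigma> Z (frob_preimage \<Sigma> q U) \<subseteq> ideal_sections \<Sigma> Z U)"

section \<open>Diagonal splittings\<close>

text \<open>
  \<open>X \<times> X\<close> is the toric variety of \<open>product_fan \<Sigma> \<Sigma>\<close>, with charts \<open>U\<^sub>\<sigma> \<times> U\<^sub>\<tau>\<close>.
  The diagonal morphism maps \<open>U\<^sub>\<sigma>\<close> into \<open>U\<^sub>\<sigma> \<times> U\<^sub>\<sigma>\<close>, and its comorphism is
  the multiplication \<open>x\<^bsup>(u, v)\<^esup> \<mapsto> x\<^bsup>u + v\<^esup>\<close>.  The diagonal is the set of its values.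
\<close>

definition codiagonal :: "(('i + 'i) \<Rightarrow>\<^sub>0 int) \<Rightarrow> ('i \<Rightarrow>\<^sub>0 int)" where
  "codiagonal w = Poly_Mapping.map_key Inl w + Poly_Mapping.map_key Inr w"

definition diagonal ::
    "(real ^ 'i::{finite,linorder}) set set \<Rightarrow> ('i + 'i, 'k::field) toric_point set" where
  "diagonal \<Sigma> =
     {point_of (product_fan \<Sigma> \<Sigma>)
        (product_cone \<sigma> \<sigma>, {f \<in> coord_ring (product_cone \<sigma> \<sigma>). monomial_map codiagonal f \<in> p})
      | \<sigma> p. (\<sigma>, p) \<in> chart_points \<Sigma>}"

text \<open>The first argument names the base field.\<close>

definition diagonally_split ::
    "'k::field itself \<Rightarrow> (real ^ 'i::{finite,linorder}) set set \<Rightarrow> nat \<Rightarrow> bool" where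
  "diagonally_split _ \<Sigma> q \<longleftrightarrow>
     (\<exists>\<pi> :: ('i + 'i, 'k) toric_point set
           \<Rightarrow> ('i + 'i, 'k) rational_function \<Rightarrow> ('i + 'i, 'k) rational_function.
        splitting (product_fan \<Sigma> \<Sigma>) q \<pi> \<and>
        compatible_with (product_fan \<Sigma> \<Sigma>) q \<pi> (diagonal \<Sigma>))"

end

(*
  Let rep choose, for every class of M / qM, a representative a with |<a, v>| < q on all rays v, and
  rep 0 = 0; in the coordinates in which the rays are binet, the residues of absolute value at most
  (q - 1) / 2 in each coordinate do this.  The k-linear map sending x^(u, v) with q | u + v to
  x^((u - a) / q, (v + a) / q), where a = rep u, and all other monomials to 0, is semilinear over
  x^w -> x^(q w) and maps 1 to 1.  The bound on a makes it preserve the coordinate ring of every chart,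
  because a cone of the fan is generated by its rays.  Under x^(u, v) -> x^(u + v) it induces the
  analogous map of k[M], so it preserves the ideal of the diagonal.

  To pass to the sheaf, a section of F_* O near a prime p has to be written as a / frob s with s not in p;
  this is lying over for the integral extension frob R of R.  Vanishing along the diagonal is tested
  at its generic point.
*)

theory Submission
  imports Defs
begin

text \<open>The pairs (a, -a) form the kernel of (u, v) -> u + v. The map is the sum, over the
  chosen representatives a, of the operation that subtracts (a, -a) from the exponent and divides by
  q, with value 0 if the division is not exact; at most one a contributes. Shifts inside the kernel
  are invisible on the diagonal, so a can be chosen freely to suit the charts. The elements a / q
  represent (1/q)M / M in the open polytope cut out by the rays. The bound is column sum times
  largest residue, 2 * (q - 1) / 2 = q - 1 < q; for even q the class of q / 2 has no representative
  below q / 2, and the same estimate would only give q.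

  On the sheaf side the obstacle is that a section is known to be regular at each prime over p
  separately, each time with its own denominator, and several primes can lie over p. One denominator
  from the image of the complement of p has to serve them all. Lying over is applied to the ideal of
  all denominators of the section to produce it.\<close>

section \<open>Primes over a prime\<close>

definition subring_set :: "'a::comm_ring_1 set \<Rightarrow> bool" where
  "subring_set R \<longleftrightarrow> 1 \<in> R \<and> (\<forall>a\<in>R. \<forall>b\<in>R. a - b \<in> R \<and> a * b \<in> R)"

definition ideal_set :: "'a::comm_ring_1 set \<Rightarrow> 'a set \<Rightarrow> bool" where
  "ideal_set R I \<longleftrightarrow> I \<subseteq> R \<and> 0 \<in> I \<and> (\<forall>a\<in>I. \<forall>b\<in>I. a + b \<in> I) \<and> (\<forall>r\<in>R. \<forall>a\<in>I. r * a \<in> I)"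

lemma subring_setD:
  assumes "subring_set R"
  shows "1 \<in> R" "0 \<in> R"
    "\<And>a b. a \<in> R \<Longrightarrow> b \<in> R \<Longrightarrow> a - b \<in> R"
    "\<And>a b. a \<in> R \<Longrightarrow> b \<in> R \<Longrightarrow> a * b \<in> R"
    "\<And>a. a \<in> R \<Longrightarrow> - a \<in> R"
    "\<And>a b. a \<in> R \<Longrightarrow> b \<in> R \<Longrightarrow> a + b \<in> R"
proof -
  show one: "1 \<in> R" and diff: "\<And>a b. a \<in> R \<Longrightarrow> b \<in> R \<Longrightarrow> a - b \<in> R"
    and "\<And>a b. a \<in> R \<Longrightarrow> b \<in> R \<Longrightarrow> a * b \<in> R"
    using assms by (auto simp: subring_set_def)
  show zero: "0 \<in> R"
    using diff[OF one one] by simp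
  show uminus: "- a \<in> R" if "a \<in> R" for a
    using diff[OF zero that] by simp
  show "a + b \<in> R" if "a \<in> R" "b \<in> R" for a b
    using diff[OF that(1) uminus[OF that(2)]] by simp
qed

lemma ideal_setD:
  assumes "ideal_set R I"
  shows "I \<subseteq> R" "0 \<in> I"
    "\<And>a b. a \<in> I \<Longrightarrow> b \<in> I \<Longrightarrow> a + b \<in> I"
    "\<And>r a. r \<in> R \<Longrightarrow> a \<in> I \<Longrightarrow> r * a \<in> I"
  using assms by (auto simp: ideal_set_def)

lemma ideal_set_diff:
  assumes "subring_set R" "ideal_set R I" "a \<in> I" "b \<in> I"
  shows "a - b \<in> I"
proof -
  have "- 1 * b \<in> I"
    using assms by (intro ideal_setD(4)[OF assms(2)] subring_setD(5)[OF assms(1)] subring_setD(1)) auto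
  then show ?thesis
    using ideal_setD(3)[OF assms(2,3)] by fastforce
qed

lemma cring_subring_set:
  fixes R :: "'a::comm_ring_1 set"
  assumes "subring_set R"
  shows "cring (ring_of_type_algebra\<lparr>carrier := R\<rparr> :: 'a ring)"
proof -
  have "\<exists>y\<in>R. x + y = 0" if "x \<in> R" for x
    using subring_setD(5)[OF assms that] by (intro bexI[of _ "- x"]) auto
  then show ?thesis
    unfolding ring_of_type_algebra_def using subring_setD[OF assms]
    by unfold_locales (auto simp: algebra_simps Units_def)
qed

text \<open>Bridge from the record-based prime ideals in \<open>spec\<close> to conditions on
  elements; later arguments about points use this form.\<close>

lemma spec_iff:
  fixes R :: "'a::comm_ring_1 set"
  assumes R: "subring_set R"
  shows "p \<in> spec R \<longleftrightarrow>
    ideal_set R p \<and> 1 \<notin> p \<and> (\<forall>a\<in>R. \<forall>b\<in>R. a * b \<in> p \<longrightarrow> a \<in> p \<or> b \<in> p)"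
proof
  let ?S = "ring_of_type_algebra\<lparr>carrier := R\<rparr> :: 'a ring"
  have S: "carrier ?S = R" "\<And>a b. a \<otimes>\<^bsub>?S\<^esub> b = a * b" "\<And>a b. a \<oplus>\<^bsub>?S\<^esub> b = a + b" "\<zero>\<^bsub>?S\<^esub> = 0"
    "\<And>a b. a \<otimes>\<^bsub>ring_of_type_algebra\<^esub> b = (a * b :: 'a)"
    by (auto simp: ring_of_type_algebra_def)
  interpret cring ?S
    by (rule cring_subring_set[OF R])
  {
    assume "p \<in> spec R"
    then interpret primeideal p ?S
      by (simp add: spec_def)
    have sub: "p \<subseteq> R"
      using a_subset by (simp add: S)
    have clos: "r * a \<in> p" if "r \<in> R" "a \<in> p" for r a
      using I_l_closed[of a r] that S by simp
    have "ideal_set R p"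
      unfolding ideal_set_def using sub clos additive_subgroup.zero_closed additive_subgroup.a_closed
      by (metis (no_types, lifting) S(3,4) is_additive_subgroup)
    moreover have "1 \<notin> p"
      using clos[of _ 1] sub I_notcarr by (auto simp: S)
    ultimately show "ideal_set R p \<and> 1 \<notin> p \<and> (\<forall>a\<in>R. \<forall>b\<in>R. a * b \<in> p \<longrightarrow> a \<in> p \<or> b \<in> p)"
      using I_prime by (simp add: S)
  }
  assume p: "ideal_set R p \<and> 1 \<notin> p \<and> (\<forall>a\<in>R. \<forall>b\<in>R. a * b \<in> p \<longrightarrow> a \<in> p \<or> b \<in> p)"
  have "additive_subgroup p ?S"
  proof (intro additive_subgroup.intro subgroup.intro)
    show "inv\<^bsub>add_monoid ?S\<^esub> x \<in> p" if "x \<in> p" for x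
    proof -
      have "x \<in> R" "- x \<in> R"
        using that p ideal_setD(1) subring_setD(5)[OF R] by auto
      then have "inv\<^bsub>add_monoid ?S\<^esub> x = - x"
        using minus_equality[of "- x" x] unfolding a_inv_def S by simp
      moreover have "- x \<in> p"
        using ideal_set_diff[OF R, of p 0 x] p ideal_setD(2) that by auto
      ultimately show ?thesis by simp
    qed
  qed (use p in \<open>auto simp: ring_of_type_algebra_def ideal_set_def\<close>)
  then have "primeideal p ?S"
  proof (rule primeidealI2)
    show "a \<otimes>\<^bsub>?S\<^esub> x \<in> p" if "a \<in> p" "x \<in> carrier ?S" for a x
      using p that by (simp add: S ideal_set_def mult.commute[of a])
  qed (use p subring_setD(1)[OF R] in \<open>auto simp: S ideal_set_def cring_subring_set[OF R]\<close>)
  then show "p \<in> spec R"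
    by (simp add: spec_def)
qed

definition ring_hom_fun :: "('a::comm_ring_1 \<Rightarrow> 'b::comm_ring_1) \<Rightarrow> bool" where
  "ring_hom_fun h \<longleftrightarrow> h 1 = 1 \<and> (\<forall>a b. h (a + b) = h a + h b \<and> h (a * b) = h a * h b)"

lemma ring_hom_funD:
  assumes "ring_hom_fun h"
  shows "h 0 = 0" "h 1 = 1" "h (a + b) = h a + h b" "h (a * b) = h a * h b" "h (a - b) = h a - h b"
proof -
  show add: "h (a + b) = h a + h b" for a b
    using assms by (simp add: ring_hom_fun_def)
  show "h 1 = 1" "h (a * b) = h a * h b"
    using assms by (auto simp: ring_hom_fun_def)
  show "h 0 = 0"
    using add[of 0 0] by simp
  show "h (a - b) = h a - h b"
    using add[of "a - b" b] by simp
qed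

text \<open>Applied to three maps: \<open>frob q\<close> for the morphism F, an inclusion of
  coordinate rings for the gluing, and \<open>comult\<close> for the diagonal.\<close>

lemma spec_contraction:
  fixes h :: "'a::comm_ring_1 \<Rightarrow> 'b::comm_ring_1"
  assumes R: "subring_set R" and R': "subring_set R'" and h: "ring_hom_fun h" and hR: "h ` R \<subseteq> R'"
    and p: "p \<in> spec R'"
  shows "{f \<in> R. h f \<in> p} \<in> spec R"
  using p hR subring_setD[OF R] unfolding spec_iff[OF R] spec_iff[OF R'] ideal_set_def
  by (auto simp: ring_hom_funD[OF h] image_subset_iff)

text \<open>
  Nakayama's lemma by Gaussian elimination: \<open>h t\<close> maps the module spanned by \<open>B\<close> over \<open>h ` R\<close> into
  its multiple by \<open>h ` p\<close>, modulo \<open>D\<close>.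
\<close>

lemma nakayama_elimination:
  fixes h :: "'a::comm_ring_1 \<Rightarrow> 'a"
  assumes R: "subring_set R" and h: "ring_hom_fun h" and hR: "h ` R \<subseteq> R"
    and p: "p \<in> spec R" and D: "ideal_set R D"
    and "finite B" and "t \<in> R - p"
    and "\<forall>b\<in>B. \<exists>s. (\<forall>b'\<in>B. s b' \<in> p) \<and> h t * b - (\<Sum>b'\<in>B. h (s b') * b') \<in> D"
  shows "\<exists>t'\<in>R - p. \<forall>b\<in>B. h t' * b \<in> D"
  using assms(6-)
proof (induction B arbitrary: t rule: finite_induct)
  case empty
  then show ?case by auto
next
  case (insert c B)
  note pD = p[unfolded spec_iff[OF R]]
  note pI = conjunct1[OF pD]
  have pR: "x \<in> R" if "x \<in> p" for x
    using ideal_setD(1)[OF pI] that by auto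
  obtain s where s: "\<And>b b'. b \<in> insert c B \<Longrightarrow> b' \<in> insert c B \<Longrightarrow> s b b' \<in> p"
    and sD: "\<And>b. b \<in> insert c B \<Longrightarrow> h t * b - (\<Sum>b'\<in>insert c B. h (s b b') * b') \<in> D"
    using insert.prems(2) by metis
  \<comment> \<open>The pivot: solving the relation for \<open>c\<close> leaves the factor
    \<open>h t1\<close> on \<open>c\<close>, and \<open>t1\<close> stays outside \<open>p\<close>
    because \<open>s c c\<close> is in \<open>p\<close>.\<close>
  define t1 where "t1 = t - s c c"
  have tR: "t \<in> R" "t \<notin> p" using insert.prems by auto
  have t1: "t1 \<in> R" "t1 \<notin> p"
  proof -
    have scc: "s c c \<in> p" using s by auto
    show "t1 \<in> R" unfolding t1_def using subring_setD(3)[OF R] tR pR[OF scc] by auto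
    show "t1 \<notin> p" using ideal_setD(3)[OF pI _ scc, of t1] tR unfolding t1_def by auto
  qed
  have tt1: "t * t1 \<in> R - p"
    using pD tR t1 subring_setD(4)[OF R] by blast
  have "\<exists>s'. (\<forall>b'\<in>B. s' b' \<in> p) \<and> h (t * t1) * b - (\<Sum>b'\<in>B. h (s' b') * b') \<in> D" if b: "b \<in> B" for b
  proof (intro exI conjI ballI)
    \<comment> \<open>Coefficients after adding \<open>h (s b c)\<close> times the relation for
      \<open>c\<close> to \<open>h t1\<close> times the relation for \<open>b\<close>; the terms in
      \<open>c\<close> cancel.\<close>
    let ?s = "\<lambda>b'. t1 * s b b' + s b c * s c b'"
    show "?s b' \<in> p" if "b' \<in> B" for b'
      using b that s t1 pR by (intro ideal_setD(3)[OF pI] ideal_setD(4)[OF pI]) auto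
    have "h t1 * (h t * b - (\<Sum>b'\<in>insert c B. h (s b b') * b'))
        + h (s b c) * (h t * c - (\<Sum>b'\<in>insert c B. h (s c b') * b')) \<in> D" (is "?x \<in> D")
      using b s t1 pR hR by (intro ideal_setD(3)[OF D] ideal_setD(4)[OF D] sD) auto
    also have "?x = h (t * t1) * b - (\<Sum>b'\<in>B. h (?s b') * b')"
      using insert.hyps
      by (simp add: t1_def ring_hom_funD[OF h] sum.distrib sum_distrib_left algebra_simps sum_subtractf)
    finally show "h (t * t1) * b - (\<Sum>b'\<in>B. h (?s b') * b') \<in> D" .
  qed
  then obtain t2 where t2: "t2 \<in> R - p" and t2D: "\<And>b. b \<in> B \<Longrightarrow> h t2 * b \<in> D"
    using insert.IH[OF tt1] by auto
  have "h (t1 * t2) * b \<in> D" if b: "b \<in> insert c B" for b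
  proof (cases "b = c")
    case True
    \<comment> \<open>Back substitution: \<open>h t2\<close> sends all of \<open>B\<close> into
      \<open>D\<close>, so the relation for \<open>c\<close>, multiplied by \<open>h t2\<close>,
      leaves only \<open>h (t1 * t2) * c\<close>.\<close>
    have "h t2 * (h t * c - (\<Sum>b'\<in>insert c B. h (s c b') * b')) + (\<Sum>b'\<in>B. h (s c b') * (h t2 * b')) \<in> D"
      (is "?x \<in> D")
    proof (rule ideal_setD(3)[OF D])
      show "h t2 * (h t * c - (\<Sum>b'\<in>insert c B. h (s c b') * b')) \<in> D"
        using t2 hR by (intro ideal_setD(4)[OF D] sD) auto
      have "(\<Sum>b'\<in>B'. h (s c b') * (h t2 * b')) \<in> D" if "B' \<subseteq> B" for B'
        using finite_subset[OF that insert.hyps(1)] that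
      proof (induction B' rule: finite_induct)
        case (insert x F)
        have "h (s c x) * (h t2 * x) \<in> D"
          using insert s pR hR by (intro ideal_setD(4)[OF D] t2D) auto
        then show ?case
          using insert ideal_setD(3)[OF D] by auto
      qed (use ideal_setD[OF D] in auto)
      then show "(\<Sum>b'\<in>B. h (s c b') * (h t2 * b')) \<in> D" by blast
    qed
    also have "?x = h (t1 * t2) * c"
      using insert.hyps
      by (simp add: t1_def ring_hom_funD[OF h] sum_distrib_left algebra_simps)
    finally show ?thesis using True by simp
  next
    case False
    then have "h t1 * (h t2 * b) \<in> D"
      using b t1 hR by (intro ideal_setD(4)[OF D] t2D) auto
    then show ?thesis by (simp add: ring_hom_funD[OF h] mult.assoc)
  qed
  moreover have "t1 * t2 \<in> R - p"
    using pD t1 t2 subring_setD(4)[OF R] by blast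
  ultimately show ?case by blast
qed

section \<open>Lying over and common denominators\<close>

definition hom_span :: "('a::comm_ring_1 \<Rightarrow> 'a) \<Rightarrow> 'a set \<Rightarrow> 'a set \<Rightarrow> 'a set" where
  "hom_span h R B = {\<Sum>b\<in>B. h (c b) * b | c. \<forall>b\<in>B. c b \<in> R}"

lemma ideal_set_adjoin:
  assumes "subring_set R" "ideal_set R I" "a \<in> R"
  shows "ideal_set R {m + a * r | m r. m \<in> I \<and> r \<in> R}"
  unfolding ideal_set_def
proof (intro conjI ballI)
  note Rd = subring_setD[OF assms(1)] and Id = ideal_setD[OF assms(2)]
  show "{m + a * r | m r. m \<in> I \<and> r \<in> R} \<subseteq> R"
    using Rd(4,6) subsetD[OF Id(1)] assms(3) by auto
  show "0 \<in> {m + a * r | m r. m \<in> I \<and> r \<in> R}"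
    using Rd(2) Id(2) by (intro CollectI exI[of _ 0]) auto
  fix x y
  assume "y \<in> {m + a * r | m r. m \<in> I \<and> r \<in> R}"
  then obtain m r where y: "y = m + a * r" "m \<in> I" "r \<in> R" by auto
  {
    assume "x \<in> {m + a * r | m r. m \<in> I \<and> r \<in> R}"
    then obtain m' r' where x: "x = m' + a * r'" "m' \<in> I" "r' \<in> R" by auto
    have "x + y = (m' + m) + a * (r' + r)"
      using x y by (simp add: algebra_simps)
    moreover have "m' + m \<in> I" "r' + r \<in> R"
      using x y Rd(6) Id(3) by auto
    ultimately show "x + y \<in> {m + a * r | m r. m \<in> I \<and> r \<in> R}"
      by blast
  }
  assume "x \<in> R"
  have "x * y = x * m + a * (x * r)"
    using y by (simp add: algebra_simps)
  moreover have "x * m \<in> I" "x * r \<in> R"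
    using y \<open>x \<in> R\<close> Rd(4) Id(4) by auto
  ultimately show "x * y \<in> {m + a * r | m r. m \<in> I \<and> r \<in> R}"
    by blast
qed

text \<open>Zorn's lemma for the ideals over \<open>D\<close> that miss \<open>T\<close>. Maximality
  is kept in the form used below for primality and for the contraction: adjoining any element
  outside \<open>P\<close> makes the ideal hit \<open>T\<close>.\<close>

lemma maximal_disjoint_ideal:
  assumes R: "subring_set R" and D: "ideal_set R D" and "D \<inter> T = {}"
  obtains P where "ideal_set R P" "D \<subseteq> P" "P \<inter> T = {}"
    "\<And>a. a \<in> R - P \<Longrightarrow> \<exists>m\<in>P. \<exists>r\<in>R. m + a * r \<in> T"
proof -
  define A where "A = {I. ideal_set R I \<and> D \<subseteq> I \<and> I \<inter> T = {}}"
  have "\<exists>M \<in> A. \<forall>J \<in> A. M \<subseteq> J \<longrightarrow> J = M"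
  proof (rule subset_Zorn_nonempty)
    show "A \<noteq> {}" using assms by (auto simp: A_def)
    fix C
    assume C: "C \<noteq> {}" "subset.chain A C"
    then have CA: "\<And>I. I \<in> C \<Longrightarrow> I \<in> A" and lin: "\<And>I J. I \<in> C \<Longrightarrow> J \<in> C \<Longrightarrow> I \<subseteq> J \<or> J \<subseteq> I"
      by (auto simp: subset_chain_def)
    have "ideal_set R (\<Union>C)"
      unfolding ideal_set_def
    proof (intro conjI ballI)
      show "\<Union>C \<subseteq> R" using CA ideal_setD(1) unfolding A_def by blast
      show "0 \<in> \<Union>C" using CA C(1) ideal_setD(2) unfolding A_def by blast
      show "a + b \<in> \<Union>C" if ab: "a \<in> \<Union>C" "b \<in> \<Union>C" for a b
      proof -
        obtain I J where IJ: "I \<in> C" "J \<in> C" "a \<in> I" "b \<in> J" using ab by auto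
        with lin[OF IJ(1,2)] obtain K where "K \<in> C" "a \<in> K" "b \<in> K" by blast
        then show ?thesis using CA[of K] ideal_setD(3)[of R K a b] unfolding A_def by blast
      qed
      show "r * a \<in> \<Union>C" if "r \<in> R" "a \<in> \<Union>C" for r a
        using that CA ideal_setD(4) unfolding A_def by blast
    qed
    then show "\<Union>C \<in> A" using CA C(1) by (auto simp: A_def)
  qed
  then obtain P where PA: "P \<in> A" and max: "\<And>J. J \<in> A \<Longrightarrow> P \<subseteq> J \<Longrightarrow> J = P"
    by metis
  then have P: "ideal_set R P" "D \<subseteq> P" "P \<inter> T = {}"
    by (simp_all add: A_def)
  have "\<exists>m\<in>P. \<exists>r\<in>R. m + a * r \<in> T" if a: "a \<in> R - P" for a
  proof (rule ccontr)
    let ?J = "{m + a * r | m r. m \<in> P \<and> r \<in> R}"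
    assume "\<not> ?thesis"
    then have disj: "?J \<inter> T = {}" by blast
    have sub: "P \<subseteq> ?J"
    proof
      show "x \<in> ?J" if "x \<in> P" for x
        using that subring_setD(2)[OF R] by (intro CollectI exI[of _ x] exI[of _ 0]) simp
    qed
    have "?J \<in> A"
      unfolding A_def using ideal_set_adjoin[OF R P(1)] a disj subset_trans[OF P(2) sub] by simp
    then have "?J = P"
      using max sub by simp
    moreover have "a \<in> ?J"
      using ideal_setD(2)[OF P(1)] subring_setD(1)[OF R] by (intro CollectI exI[of _ 0] exI[of _ 1]) simp
    ultimately show False using a by blast
  qed
  with P that show ?thesis by blast
qed

text \<open>
  Lying over for an integral extension \<open>h ` R \<subseteq> R\<close>, with integrality stated as \<open>r\<close> acting on a finite module
  containing \<open>1\<close>.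
\<close>

lemma prime_lying_over:
  fixes h :: "'a::idom \<Rightarrow> 'a"
  assumes R: "subring_set R" and h: "ring_hom_fun h" and hR: "h ` R \<subseteq> R"
    and int: "\<And>r. r \<in> R \<Longrightarrow> \<exists>B\<subseteq>R. finite B \<and> 1 \<in> B \<and> (\<forall>b\<in>B. r * b \<in> hom_span h R B)"
    and p: "p \<in> spec R" and D: "ideal_set R D" and disj: "D \<inter> h ` (R - p) = {}"
  obtains P where "P \<in> spec R" "D \<subseteq> P" "{f \<in> R. h f \<in> P} = p"
proof -
  note pD = p[unfolded spec_iff[OF R]]
  note pI = conjunct1[OF pD]
  note Rd = subring_setD[OF R]
  obtain P where P: "ideal_set R P" "D \<subseteq> P" "P \<inter> h ` (R - p) = {}"
    and max: "\<And>a. a \<in> R - P \<Longrightarrow> \<exists>m\<in>P. \<exists>r\<in>R. m + a * r \<in> h ` (R - p)"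
    using maximal_disjoint_ideal[OF R D disj] by blast
  note Pd = ideal_setD[OF P(1)]
  have "P \<in> spec R"
    unfolding spec_iff[OF R]
  proof (intro conjI ballI impI P(1))
    have "1 \<in> R - p" using pD Rd by auto
    then have "1 \<in> h ` (R - p)" using ring_hom_funD(2)[OF h] by (metis imageI)
    then show "1 \<notin> P" using P(3) by blast
    fix a b
    assume ab: "a \<in> R" "b \<in> R" "a * b \<in> P"
    show "a \<in> P \<or> b \<in> P"
    proof (rule ccontr)
      assume "\<not> ?thesis"
      then have "a \<in> R - P" "b \<in> R - P" using ab by auto
      then obtain m r m' r' t t' where mr: "m \<in> P" "r \<in> R" "m + a * r = h t" "t \<in> R - p"
        "m' \<in> P" "r' \<in> R" "m' + b * r' = h t'" "t' \<in> R - p"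
        using max[of a] max[of b] unfolding image_iff by blast
      \<comment> \<open>Product of the two hits \<open>m + a * r\<close> and
        \<open>m' + b * r'\<close>: every term contains \<open>m\<close>, \<open>m'\<close> or
        \<open>a * b\<close>, so it lies in \<open>P\<close>, although \<open>t * t'\<close> is
        outside \<open>p\<close>.\<close>
      have "h (t * t') = (m' + b * r') * m + ((a * r) * m' + (r * r') * (a * b))"
        by (simp add: ring_hom_funD[OF h] mr(3,7)[symmetric] algebra_simps)
      also have "\<dots> \<in> P"
        by (intro Pd(3) Pd(4) Rd(4) Rd(6) subsetD[OF Pd(1) mr(5)] mr ab)
      finally have "h (t * t') \<in> P" .
      moreover have "t * t' \<in> R - p"
        using mr pD Rd(4) by blast
      ultimately show False using P(3) by blast
    qed
  qed
  moreover have "{f \<in> R. h f \<in> P} = p"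
  proof
    show "{f \<in> R. h f \<in> P} \<subseteq> p" using P(3) by blast
    have "h s \<in> P" if s: "s \<in> p" for s
    proof (rule ccontr)
      assume "h s \<notin> P"
      have sR: "s \<in> R" using s ideal_setD(1)[OF pI] by auto
      with \<open>h s \<notin> P\<close> hR have "h s \<in> R - P" by auto
      then obtain m r t where mr: "m \<in> P" "r \<in> R" "m + h s * r = h t" and t: "t \<in> R - p"
        using max[of "h s"] by (metis imageE)
      obtain B where B: "B \<subseteq> R" "finite B" "1 \<in> B" "\<And>b. b \<in> B \<Longrightarrow> r * b \<in> hom_span h R B"
        using int[OF mr(2)] by blast
      \<comment> \<open>Modulo \<open>P\<close>, \<open>h t\<close> acts on the span of
        \<open>B\<close> as \<open>h s * r\<close>. Integrality of \<open>r\<close> gives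
        coefficients in \<open>R\<close>, and the factor \<open>s\<close> puts them in
        \<open>p\<close>. Elimination then yields \<open>t'\<close> outside \<open>p\<close> with
        \<open>h t' * b\<close> in \<open>P\<close> for all \<open>b\<close> in \<open>B\<close>, in
        particular for 1.\<close>
      have "\<exists>s'. (\<forall>b'\<in>B. s' b' \<in> p) \<and> h t * b - (\<Sum>b'\<in>B. h (s' b') * b') \<in> P" if b: "b \<in> B" for b
      proof -
        obtain c where c: "\<And>b'. b' \<in> B \<Longrightarrow> c b' \<in> R" "r * b = (\<Sum>b'\<in>B. h (c b') * b')"
          using B(4)[OF b] by (auto simp: hom_span_def)
        have "(\<Sum>b'\<in>B. h (c b' * s) * b') = h s * (r * b)"
          unfolding c(2) by (simp add: ring_hom_funD[OF h] sum_distrib_left mult_ac)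
        then have "h t * b - (\<Sum>b'\<in>B. h (c b' * s) * b') = b * m"
          by (simp add: mr(3)[symmetric] algebra_simps)
        also have "\<dots> \<in> P" using Pd(4) mr b B by auto
        finally show ?thesis
          using c(1) ideal_setD(4)[OF pI _ s] by (intro exI[of _ "\<lambda>b'. c b' * s"]) auto
      qed
      then obtain t' where "t' \<in> R - p" "\<And>b. b \<in> B \<Longrightarrow> h t' * b \<in> P"
        using nakayama_elimination[OF R h hR p P(1) B(2) t] by blast
      then show False using B(3) P(3) by force
    qed
    then show "p \<subseteq> {f \<in> R. h f \<in> P}" using ideal_setD(1)[OF pI] by auto
  qed
  ultimately show ?thesis using that P(2) by blast
qed

text \<open>Let \<open>D\<close> be the ideal of denominators of \<open>f\<close>. At each prime
  \<open>P\<close> over \<open>p\<close> the hypothesis supplies a denominator outside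
  \<open>P\<close>, so \<open>D\<close> lies in no prime over \<open>p\<close>. By
  \<open>prime_lying_over\<close> it must then meet the image of \<open>R - p\<close> under
  \<open>h\<close>.\<close>

lemma local_rings_over_prime:
  fixes h :: "'a::idom \<Rightarrow> 'a"
  assumes R: "subring_set R" and h: "ring_hom_fun h" and inj: "inj h" and hR: "h ` R \<subseteq> R"
    and int: "\<And>r. r \<in> R \<Longrightarrow> \<exists>B\<subseteq>R. finite B \<and> 1 \<in> B \<and> (\<forall>b\<in>B. r * b \<in> hom_span h R B)"
    and p: "p \<in> spec R"
    and f: "\<And>P. P \<in> spec R \<Longrightarrow> {g \<in> R. h g \<in> P} = p \<Longrightarrow> f \<in> local_ring R P"
  obtains a s where "a \<in> R" "s \<in> R - p" "h s \<noteq> 0" "f = Fract a (h s)"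
proof -
  note Rd = subring_setD[OF R]
  define D where "D = {b \<in> R. \<exists>a\<in>R. f * Fract b 1 = Fract a 1}"
  have zero_p: "0 \<in> p"
    using p spec_iff[OF R] ideal_setD(2) by blast
  have "ideal_set R D"
    unfolding ideal_set_def
  proof (intro conjI ballI)
    show "D \<subseteq> R" by (auto simp: D_def)
    show "0 \<in> D" using Rd(2) by (auto simp: D_def Zero_fract_def[symmetric] intro: bexI[of _ 0])
    show "b + c \<in> D" if bc: "b \<in> D" "c \<in> D" for b c
    proof -
      obtain x y where xy: "x \<in> R" "y \<in> R" "f * Fract b 1 = Fract x 1" "f * Fract c 1 = Fract y 1"
        "b \<in> R" "c \<in> R"
        using bc by (auto simp: D_def)
      have "f * Fract (b + c) 1 = f * Fract b 1 + f * Fract c 1"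
        by (simp add: distrib_left[symmetric])
      also have "\<dots> = Fract (x + y) 1" by (simp add: xy)
      finally show ?thesis using xy Rd by (auto simp: D_def)
    qed
    show "r * b \<in> D" if rb: "r \<in> R" "b \<in> D" for r b
    proof -
      obtain x where x: "x \<in> R" "f * Fract b 1 = Fract x 1" "b \<in> R"
        using rb by (auto simp: D_def)
      have "f * Fract (r * b) 1 = Fract r 1 * (f * Fract b 1)"
        by (simp add: mult.left_commute[of "Fract r 1"])
      also have "\<dots> = Fract (r * x) 1" by (simp add: x)
      finally show ?thesis using x rb Rd by (auto simp: D_def)
    qed
  qed
  have "\<not> D \<inter> h ` (R - p) = {}"
  proof
    assume "D \<inter> h ` (R - p) = {}"
    then obtain P where P: "P \<in> spec R" "D \<subseteq> P" "{g \<in> R. h g \<in> P} = p"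
      using prime_lying_over[OF R h hR int p \<open>ideal_set R D\<close>] by metis
    then obtain a b where ab: "f = Fract a b" "a \<in> R" "b \<in> R" "b \<notin> P"
      using f[OF P(1,3)] by (auto simp: local_ring_def)
    have "0 \<in> P" using P(1) spec_iff[OF R] ideal_setD(2) by blast
    then have "b \<noteq> 0" using ab by auto
    then have "f * Fract b 1 = Fract a 1"
      by (simp add: ab eq_fract)
    then show False using P(2) ab by (auto simp: D_def)
  qed
  then obtain s a where s: "s \<in> R - p" "a \<in> R" "f * Fract (h s) 1 = Fract a 1"
    by (auto simp: D_def)
  have "s \<noteq> 0" using s zero_p by auto
  then have hs: "h s \<noteq> 0"
    using inj ring_hom_funD(1)[OF h] by (metis injD)
  have "f = f * Fract (h s) 1 * Fract 1 (h s)"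
    using hs by (simp add: mult.assoc eq_fract One_fract_def)
  then have "f = Fract a (h s)"
    using s by simp
  with s hs that show ?thesis by blast
qed

section \<open>Linear maps between Laurent polynomial rings\<close>

lemma poly_mapping_sum_single: "f = (\<Sum>u\<in>Poly_Mapping.keys f. Poly_Mapping.single u (Poly_Mapping.lookup f u))"
proof (rule poly_mapping_eqI)
  fix k
  have "(\<Sum>u\<in>Poly_Mapping.keys f. Poly_Mapping.lookup (Poly_Mapping.single u (Poly_Mapping.lookup f u)) k)
    = (\<Sum>u\<in>Poly_Mapping.keys f. if u = k then Poly_Mapping.lookup f k else 0)"
    by (intro sum.cong) (auto simp: lookup_single)
  then show "Poly_Mapping.lookup f k =
      Poly_Mapping.lookup (\<Sum>u\<in>Poly_Mapping.keys f. Poly_Mapping.single u (Poly_Mapping.lookup f u)) k"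
    by (simp add: lookup_sum in_keys_iff)
qed

lemma poly_mapping_induct_add [case_names single add]:
  fixes f :: "'a \<Rightarrow>\<^sub>0 'b::comm_monoid_add"
  assumes "\<And>u c. P (Poly_Mapping.single u c)" and "\<And>f g. P f \<Longrightarrow> P g \<Longrightarrow> P (f + g)"
  shows "P f"
proof -
  have "P 0"
    using assms(1)[of _ 0] by simp
  have "P (\<Sum>u\<in>A. Poly_Mapping.single u (Poly_Mapping.lookup f u))" if "finite A" for A
    using that by (induction A rule: finite_induct) (auto intro: assms \<open>P 0\<close>)
  then show ?thesis
    using poly_mapping_sum_single[of f] by (metis finite_keys)
qed

text \<open>Scalars enter as constants \<open>single 0 c\<close>, so that linear extension over k is
  ring multiplication. Both \<open>monomial_map\<close> and the splittings have this shape, which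
  reduces identities between them to monomials.\<close>

definition lin_ext :: "('a \<Rightarrow> 'b::comm_monoid_add \<Rightarrow>\<^sub>0 'k) \<Rightarrow> ('a \<Rightarrow>\<^sub>0 'k::comm_semiring_1) \<Rightarrow> 'b \<Rightarrow>\<^sub>0 'k" where
  "lin_ext g f = (\<Sum>u\<in>Poly_Mapping.keys f. Poly_Mapping.single 0 (Poly_Mapping.lookup f u) * g u)"

lemma lin_ext_single [simp]: "lin_ext g (Poly_Mapping.single u c) = Poly_Mapping.single 0 c * g u"
  by (simp add: lin_ext_def)

lemma lin_ext_add: "lin_ext g (f + f') = lin_ext g f + lin_ext g f'"
proof -
  let ?A = "Poly_Mapping.keys f \<union> Poly_Mapping.keys f'"
  have *: "lin_ext g h = (\<Sum>u\<in>?A. Poly_Mapping.single 0 (Poly_Mapping.lookup h u) * g u)"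
    if "Poly_Mapping.keys h \<subseteq> ?A" for h
    unfolding lin_ext_def using that by (intro sum.mono_neutral_left) (auto simp: in_keys_iff)
  show ?thesis
    using *[of f] *[of f'] *[of "f + f'"] Poly_Mapping.keys_add[of f f']
    by (simp add: lookup_add single_add distrib_right sum.distrib)
qed

lemma lin_ext_zero [simp]: "lin_ext g 0 = 0"
  by (simp add: lin_ext_def)

lemma additive_eqI:
  fixes F G :: "('a \<Rightarrow>\<^sub>0 'k::comm_monoid_add) \<Rightarrow> 'c::plus"
  assumes "\<And>f f'. F (f + f') = F f + F f'" "\<And>f f'. G (f + f') = G f + G f'"
    and "\<And>u c. F (Poly_Mapping.single u c) = G (Poly_Mapping.single u c)"
  shows "F f = G f"
  by (induction f rule: poly_mapping_induct_add) (simp_all add: assms)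

lemma monomial_map_lin_ext: "monomial_map \<phi> f = lin_ext (\<lambda>u. Poly_Mapping.single (\<phi> u) 1) f"
  by (simp add: monomial_map_def lin_ext_def mult_single)

lemma monomial_map_single [simp]:
  "monomial_map \<phi> (Poly_Mapping.single u c) = Poly_Mapping.single (\<phi> u) c"
  by (simp add: monomial_map_lin_ext mult_single)

lemma monomial_map_add: "monomial_map \<phi> (f + g) = monomial_map \<phi> f + monomial_map \<phi> g"
  by (simp add: monomial_map_lin_ext lin_ext_add)

lemma ring_hom_monomial_map:
  fixes \<phi> :: "('i::linorder \<Rightarrow>\<^sub>0 int) \<Rightarrow> ('j::linorder \<Rightarrow>\<^sub>0 int)"
  assumes "\<phi> 0 = 0" and "\<And>u v. \<phi> (u + v) = \<phi> u + \<phi> v"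
  shows "ring_hom_fun (monomial_map \<phi> :: ('i, 'k::field) laurent \<Rightarrow> _)"
proof -
  have "monomial_map \<phi> (Poly_Mapping.single u c * g)
      = monomial_map \<phi> (Poly_Mapping.single u c) * monomial_map \<phi> g" for u c and g :: "('i, 'k) laurent"
    by (induction g rule: poly_mapping_induct_add)
      (simp_all add: mult_single assms monomial_map_add distrib_left)
  then have "monomial_map \<phi> (f * g) = monomial_map \<phi> f * monomial_map \<phi> g" for f g :: "('i, 'k) laurent"
    by (induction f rule: poly_mapping_induct_add) (simp_all add: monomial_map_add distrib_right)
  moreover have "monomial_map \<phi> (1 :: ('i, 'k) laurent) = 1"
    using monomial_map_single[of \<phi> 0 1] by (simp add: assms)
  ultimately show ?thesis
    by (simp add: ring_hom_fun_def monomial_map_add)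
qed

lemma lin_ext_monomial_map: "lin_ext g (monomial_map \<phi> f) = lin_ext (g \<circ> \<phi>) f"
  by (rule additive_eqI) (simp_all add: monomial_map_add lin_ext_add)

lemma monomial_map_lin_ext_comp:
  fixes \<phi> :: "('i::linorder \<Rightarrow>\<^sub>0 int) \<Rightarrow> ('j::linorder \<Rightarrow>\<^sub>0 int)"
    and g :: "'a \<Rightarrow> ('i, 'k::field) laurent"
  assumes "\<phi> 0 = 0" and "\<And>u v. \<phi> (u + v) = \<phi> u + \<phi> v"
  shows "monomial_map \<phi> (lin_ext g f) = lin_ext (monomial_map \<phi> \<circ> g) f"
  by (rule additive_eqI[where F = "\<lambda>f. monomial_map \<phi> (lin_ext g f)"])
    (simp_all add: monomial_map_add lin_ext_add ring_hom_funD[OF ring_hom_monomial_map, OF assms] assms)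

section \<open>The map \<open>frob\<close>\<close>

definition scale :: "nat \<Rightarrow> ('i \<Rightarrow>\<^sub>0 int) \<Rightarrow> ('i \<Rightarrow>\<^sub>0 int)" where
  "scale q = Poly_Mapping.map (\<lambda>m. int q * m)"

lemma lookup_scale [simp]: "Poly_Mapping.lookup (scale q u) i = int q * Poly_Mapping.lookup u i"
  by (simp add: scale_def Poly_Mapping.map.rep_eq when_def)

lemma scale_add: "scale q (u + v) = scale q u + scale q v"
  by (rule poly_mapping_eqI) (simp add: lookup_add distrib_left)

lemma scale_zero: "scale q 0 = 0"
  by (rule poly_mapping_eqI) simp

lemma ring_hom_frob: "ring_hom_fun (frob q :: ('i::linorder, 'k::field) laurent \<Rightarrow> _)"
  unfolding frob_def scale_def[symmetric] by (rule ring_hom_monomial_map) (simp_all add: scale_zero scale_add)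

lemma frob_single [simp]: "frob q (Poly_Mapping.single u c) = Poly_Mapping.single (scale q u) c"
  by (simp add: frob_def scale_def)

text \<open>
  For such \<open>g\<close>, \<open>lin_ext g\<close> is semilinear with respect to \<open>frob q\<close>: the algebraic form of an
  \<open>\<O>\<close>-module map \<open>F\<^sub>*\<O> \<rightarrow> \<O>\<close>.
\<close>

definition frob_equivariant :: "nat \<Rightarrow> (('i::linorder \<Rightarrow>\<^sub>0 int) \<Rightarrow> ('i, 'k::field) laurent) \<Rightarrow> bool" where
  "frob_equivariant q g \<longleftrightarrow> g 0 = 1 \<and> (\<forall>u w. g (scale q u + w) = Poly_Mapping.single u 1 * g w)"

lemma lin_ext_frob_mult:
  fixes g :: "('i::linorder \<Rightarrow>\<^sub>0 int) \<Rightarrow> ('i, 'k::field) laurent"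
  assumes "frob_equivariant q g"
  shows "lin_ext g (frob q a * f) = a * lin_ext g f"
proof (induction a rule: poly_mapping_induct_add)
  case (single u c)
  show ?case
  proof (induction f rule: poly_mapping_induct_add)
    case (single w d)
    have "lin_ext g (frob q (Poly_Mapping.single u c) * Poly_Mapping.single w d)
        = Poly_Mapping.single 0 (c * d) * Poly_Mapping.single u 1 * g w"
      using assms by (simp add: mult_single frob_equivariant_def mult.assoc)
    also have "Poly_Mapping.single 0 (c * d) * Poly_Mapping.single u 1
        = Poly_Mapping.single u c * Poly_Mapping.single 0 d"
      by (simp add: mult_single)
    finally show ?case by (simp add: mult.assoc)
  qed (simp_all add: lin_ext_add distrib_left)
qed (simp_all add: lin_ext_add distrib_right ring_hom_funD[OF ring_hom_frob])

lemma lin_ext_frob: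
  fixes g :: "('i::linorder \<Rightarrow>\<^sub>0 int) \<Rightarrow> ('i, 'k::field) laurent"
  assumes "frob_equivariant q g"
  shows "lin_ext g (frob q a) = a"
proof -
  have "lin_ext g 1 = 1"
    using lin_ext_single[of g 0 1] assms by (simp add: frob_equivariant_def)
  then show ?thesis
    using lin_ext_frob_mult[OF assms, of a 1] by simp
qed

text \<open>The standard splitting x^w -> x^(w/q) of \<open>frob q\<close> on k[M]. It gives the
  left inverse that proves \<open>frob q\<close> injective, and it is the map that the splitting of
  X x X induces on the diagonal.\<close>

definition exact_root :: "nat \<Rightarrow> ('i::linorder \<Rightarrow>\<^sub>0 int) \<Rightarrow> ('i, 'k::field) laurent" where
  "exact_root q w = (if \<forall>i. int q dvd Poly_Mapping.lookup w i
     then Poly_Mapping.single (Poly_Mapping.map (\<lambda>m. m div int q) w) 1 else 0)"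

lemma lookup_map_div [simp]:
  "Poly_Mapping.lookup (Poly_Mapping.map (\<lambda>m. m div int q) u) i = Poly_Mapping.lookup u i div int q"
  by (simp add: Poly_Mapping.map.rep_eq when_def)

lemma frob_equivariant_exact_root:
  assumes "q > 0"
  shows "frob_equivariant q (exact_root q :: ('i::linorder \<Rightarrow>\<^sub>0 int) \<Rightarrow> ('i, 'k::field) laurent)"
proof -
  have "Poly_Mapping.map (\<lambda>m. m div int q) (scale q u + w) = u + Poly_Mapping.map (\<lambda>m. m div int q) w"
    for u w :: "'i \<Rightarrow>\<^sub>0 int"
    using assms by (intro poly_mapping_eqI) (simp add: lookup_add)
  moreover have "Poly_Mapping.map (\<lambda>m. m div int q) 0 = (0 :: 'i \<Rightarrow>\<^sub>0 int)"
    by (rule poly_mapping_eqI) simp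
  moreover have "int q dvd int q * m + n \<longleftrightarrow> int q dvd n" for m n
    by (simp add: dvd_add_right_iff)
  ultimately show ?thesis
    by (simp add: frob_equivariant_def exact_root_def lookup_add mult_single)
qed

lemma inj_frob:
  assumes "q > 0"
  shows "inj (frob q :: ('i::linorder, 'k::field) laurent \<Rightarrow> _)"
  using lin_ext_frob[OF frob_equivariant_exact_root[OF assms]] by (rule inj_on_inverseI)

section \<open>Coordinate rings\<close>

lemma pairing_zero [simp]: "pairing 0 x = 0" "pairing u 0 = 0"
  by (simp_all add: pairing_def)

lemma pairing_add: "pairing (u + v) x = pairing u x + pairing v x"
  by (simp add: pairing_def lookup_add distrib_right sum.distrib)

lemma pairing_scale: "pairing (scale q u) x = real q * pairing u x"
  by (simp add: pairing_def sum_distrib_left mult.assoc)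

lemma dual_monoid_add: "u \<in> dual_monoid C \<Longrightarrow> v \<in> dual_monoid C \<Longrightarrow> u + v \<in> dual_monoid C"
  by (simp add: dual_monoid_def pairing_add)

lemma subring_coord_ring: "subring_set (coord_ring C :: ('i::{finite,linorder}, 'k::field) laurent set)"
  unfolding subring_set_def
proof (intro conjI ballI)
  show "1 \<in> coord_ring C"
    by (auto simp: coord_ring_def dual_monoid_def)
  fix f g :: "('i, 'k) laurent"
  assume fg: "f \<in> coord_ring C" "g \<in> coord_ring C"
  have "Poly_Mapping.keys (f - g) \<subseteq> Poly_Mapping.keys f \<union> Poly_Mapping.keys g"
    by (auto simp: in_keys_iff lookup_minus)
  then show "f - g \<in> coord_ring C"
    using fg by (auto simp: coord_ring_def)
  show "f * g \<in> coord_ring C"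
    using fg Poly_Mapping.keys_mult[of f g] by (auto simp: coord_ring_def intro!: dual_monoid_add)
qed

lemmas coord_ringD = subring_setD[OF subring_coord_ring]

lemma single_in_coord_ring: "u \<in> dual_monoid C \<Longrightarrow> Poly_Mapping.single u c \<in> coord_ring C"
  by (auto simp: coord_ring_def split: if_splits)

lemma sum_in_coord_ring: "(\<And>x. x \<in> A \<Longrightarrow> f x \<in> coord_ring C) \<Longrightarrow> sum f A \<in> coord_ring C"
  by (induction A rule: infinite_finite_induct) (auto intro: coord_ringD)

lemma lin_ext_coord_ring:
  assumes "\<And>u. u \<in> dual_monoid C \<Longrightarrow> g u \<in> coord_ring C'" and "f \<in> coord_ring C"
  shows "lin_ext g f \<in> coord_ring C'"
  unfolding lin_ext_def using assms
  by (intro sum_in_coord_ring coord_ringD(4) single_in_coord_ring) (auto simp: coord_ring_def dual_monoid_def)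

lemma frob_coord_ring: "frob q ` coord_ring C \<subseteq> (coord_ring C :: ('i::{finite,linorder}, 'k::field) laurent set)"
  unfolding frob_def scale_def[symmetric] monomial_map_lin_ext
  by (intro image_subsetI lin_ext_coord_ring single_in_coord_ring)
    (auto simp: dual_monoid_def pairing_scale)

lemma coord_ring_antimono: "C \<subseteq> C' \<Longrightarrow> coord_ring C' \<subseteq> coord_ring C"
  by (auto simp: coord_ring_def dual_monoid_def)

section \<open>Integrality of coordinate rings over the image of \<open>frob q\<close>\<close>

lemma hom_span_add:
  assumes "ring_hom_fun h" "subring_set R" "x \<in> hom_span h R B" "y \<in> hom_span h R B"
  shows "x + y \<in> hom_span h R B"
proof -
  obtain c d where "x = (\<Sum>b\<in>B. h (c b) * b)" "y = (\<Sum>b\<in>B. h (d b) * b)"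
    and R: "\<forall>b\<in>B. c b \<in> R" "\<forall>b\<in>B. d b \<in> R"
    using assms by (auto simp: hom_span_def)
  then have "x + y = (\<Sum>b\<in>B. h (c b + d b) * b)"
    by (simp add: ring_hom_funD[OF assms(1)] distrib_right sum.distrib)
  then show ?thesis
    unfolding hom_span_def using R subring_setD(6)[OF assms(2)] by (intro CollectI exI[of _ "\<lambda>b. c b + d b"]) auto
qed

lemma hom_span_base:
  assumes "ring_hom_fun h" "subring_set R" "finite B" "b \<in> B" "r \<in> R"
  shows "h r * b \<in> hom_span h R B"
proof -
  have "(\<Sum>b'\<in>B. h (if b' = b then r else 0) * b') = (\<Sum>b'\<in>B. if b' = b then h r * b else 0)"
    by (intro sum.cong) (auto simp: ring_hom_funD[OF assms(1)])
  also have "\<dots> = h r * b" using assms by simp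
  finally show ?thesis
    unfolding hom_span_def using assms subring_setD(2)[OF assms(2)]
    by (intro CollectI exI[of _ "\<lambda>b'. if b' = b then r else 0"]) auto
qed

text \<open>The relation \<open>(x\<^sup>u)\<^sup>q = frob q x\<^sup>u\<close> makes the monomials with exponents below \<open>q\<close> sufficient.\<close>

lemma finite_monomial_basis:
  fixes U :: "('i::{finite,linorder} \<Rightarrow>\<^sub>0 int) set"
  assumes "q > 0" and "finite U" and "U \<subseteq> dual_monoid C"
  shows "\<exists>B\<subseteq>(coord_ring C :: ('i, 'k::field) laurent set). finite B \<and> 1 \<in> B \<and>
    (\<forall>u\<in>U. \<forall>b\<in>B. \<exists>v\<in>coord_ring C. \<exists>b'\<in>B. Poly_Mapping.single u 1 * b = frob q v * b')"
  using assms(2,3)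
proof (induction U rule: finite_induct)
  case empty
  then show ?case using coord_ringD(1) by (intro exI[of _ "{1}"]) auto
next
  case (insert u U)
  then obtain B where B: "B \<subseteq> (coord_ring C :: ('i, 'k) laurent set)" "finite B" "1 \<in> B"
    and step: "\<And>v b. v \<in> U \<Longrightarrow> b \<in> B \<Longrightarrow> \<exists>w\<in>coord_ring C. \<exists>b'\<in>B. Poly_Mapping.single v 1 * b = frob q w * b'"
    by (metis insert_subset)
  define x :: "('i, 'k) laurent" where "x = Poly_Mapping.single u 1"
  have xR: "x \<in> coord_ring C" using insert.prems by (auto simp: x_def intro: single_in_coord_ring)
  then have xk: "x ^ k \<in> coord_ring C" for k by (induction k) (auto intro: coord_ringD)
  have "x ^ k = Poly_Mapping.single (scale k u) 1" for k
  proof (induction k)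
    case 0
    have "scale 0 u = 0" by (rule poly_mapping_eqI) simp
    then show ?case by simp
  next
    case (Suc k)
    have "scale (Suc k) u = u + scale k u"
      by (rule poly_mapping_eqI) (simp add: lookup_add distrib_right)
    then show ?case by (simp add: Suc) (simp add: x_def mult_single)
  qed
  then have xq: "x ^ q = frob q x" by (simp add: x_def)
  \<comment> \<open>The powers of \<open>x\<close> below \<open>q\<close> multiply the basis found
    for \<open>U\<close>; the power 0 keeps 1 in the set.\<close>
  let ?B = "(\<lambda>(k, b). x ^ k * b) ` ({..<q} \<times> B)"
  have mem: "x ^ k * b \<in> ?B" if "k < q" "b \<in> B" for k b
    using that by force
  show ?case
  proof (intro exI[of _ ?B] conjI ballI)
    show "?B \<subseteq> coord_ring C" using B(1) xk by (auto intro!: coord_ringD)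
    show "finite ?B" using B by simp
    show "1 \<in> ?B" using mem[of 0 1] B assms(1) by simp
    fix v b assume v: "v \<in> insert u U" and "b \<in> ?B"
    then obtain k b0 where b: "b = x ^ k * b0" "k < q" "b0 \<in> B" by auto
    show "\<exists>w\<in>coord_ring C. \<exists>b'\<in>?B. Poly_Mapping.single v 1 * b = frob q w * b'"
    proof (cases "v = u")
      case False
      then obtain w b' where w: "w \<in> coord_ring C" "b' \<in> B" "Poly_Mapping.single v 1 * b0 = frob q w * b'"
        using step[of v b0] v b by auto
      have "Poly_Mapping.single v 1 * b = x ^ k * (Poly_Mapping.single v 1 * b0)"
        by (simp add: b mult_ac)
      also have "\<dots> = frob q w * (x ^ k * b')"
        unfolding w(3) by (rule mult.left_commute)
      finally have eq: "Poly_Mapping.single v 1 * b = frob q w * (x ^ k * b')" .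
      show ?thesis
        by (intro bexI[OF _ w(1)] bexI[OF _ mem[OF b(2) w(2)]] eq)
    next
      case True
      show ?thesis
      proof (cases "Suc k < q")
        case True
        have eq: "Poly_Mapping.single v 1 * b = frob q 1 * (x ^ Suc k * b0)"
          by (simp add: b \<open>v = u\<close> x_def[symmetric] ring_hom_funD[OF ring_hom_frob] mult.assoc)
        show ?thesis
          by (intro bexI[OF _ coord_ringD(1)] bexI[OF _ mem[OF True b(3)]] eq)
      next
        case False
        \<comment> \<open>Wrap-around: \<open>x ^ q = frob q x\<close> becomes the coefficient and
          the power of \<open>x\<close> restarts at 0.\<close>
        then have "Suc k = q" using b by simp
        then have eq: "Poly_Mapping.single v 1 * b = frob q x * (x ^ 0 * b0)"
          unfolding \<open>v = u\<close> x_def[symmetric] xq[symmetric] b(1) by (auto simp: mult.assoc)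
        show ?thesis
          by (intro bexI[OF _ xR] bexI[OF _ mem[OF assms(1) b(3)]] eq)
      qed
    qed
  qed
qed

text \<open>\<open>B\<close> is built from the finitely many exponents of \<open>r\<close> and may
  vary with \<open>r\<close>. Coefficients from k are absorbed because \<open>frob q\<close> fixes
  constants.\<close>

lemma coord_ring_integral_over_frob:
  fixes r :: "('i::{finite,linorder}, 'k::field) laurent"
  assumes "q > 0" and r: "r \<in> coord_ring C"
  shows "\<exists>B\<subseteq>coord_ring C. finite B \<and> 1 \<in> B \<and> (\<forall>b\<in>B. r * b \<in> hom_span (frob q) (coord_ring C) B)"
proof -
  have "Poly_Mapping.keys r \<subseteq> dual_monoid C"
    using r by (simp add: coord_ring_def)
  from finite_monomial_basis[OF assms(1) finite_keys this]
  obtain B where B: "B \<subseteq> (coord_ring C :: ('i, 'k) laurent set)" "finite B" "1 \<in> B"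
    and step: "\<And>u b. u \<in> Poly_Mapping.keys r \<Longrightarrow> b \<in> B \<Longrightarrow>
      \<exists>v\<in>coord_ring C. \<exists>b'\<in>B. Poly_Mapping.single u 1 * b = frob q v * b'"
    by metis
  note span = hom_span_add[OF ring_hom_frob subring_coord_ring]
    hom_span_base[OF ring_hom_frob subring_coord_ring B(2)]
  have single: "Poly_Mapping.single u c * b \<in> hom_span (frob q) (coord_ring C) B"
    if "u \<in> Poly_Mapping.keys r" "b \<in> B" for u c b
  proof -
    obtain v b' where v: "v \<in> coord_ring C" "b' \<in> B" "Poly_Mapping.single u 1 * b = frob q v * b'"
      using step \<open>u \<in> _\<close> \<open>b \<in> _\<close> by blast
    have "Poly_Mapping.single u c * b = Poly_Mapping.single 0 c * (Poly_Mapping.single u 1 * b)"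
      by (simp add: mult_single mult.assoc[symmetric])
    also have "\<dots> = frob q (Poly_Mapping.single 0 c * v) * b'"
      by (simp add: v ring_hom_funD[OF ring_hom_frob] scale_zero mult.assoc)
    also have "\<dots> \<in> hom_span (frob q) (coord_ring C) B"
      using v by (intro span coord_ringD single_in_coord_ring) (auto simp: dual_monoid_def)
    finally show ?thesis .
  qed
  have "(\<Sum>u\<in>A. Poly_Mapping.single u (Poly_Mapping.lookup r u)) * b \<in> hom_span (frob q) (coord_ring C) B"
    if "finite A" "A \<subseteq> Poly_Mapping.keys r" "b \<in> B" for A b
    using that
  proof (induction A rule: finite_induct)
    case empty
    have "frob q 0 * b \<in> hom_span (frob q) (coord_ring C) B"
      by (rule span(2)[OF empty(2) coord_ringD(2)])
    then show ?case
      by (simp add: ring_hom_funD[OF ring_hom_frob])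
  next
    case (insert u A)
    then show ?case
      using span(1)[OF single[of u b]] by (simp add: distrib_right)
  qed
  then have "r * b \<in> hom_span (frob q) (coord_ring C) B" if "b \<in> B" for b
    using poly_mapping_sum_single[of r] that by (metis finite_keys subset_refl)
  with B show ?thesis by blast
qed

section \<open>Splittings induced by equivariant maps\<close>

definition frob_prime ::
    "nat \<Rightarrow> (real ^ 'i::{finite,linorder}) set \<Rightarrow> ('i, 'k::field) laurent set \<Rightarrow> ('i, 'k) laurent set" where
  "frob_prime q \<sigma> p = {f \<in> coord_ring \<sigma>. frob q f \<in> p}"

lemma frob_prime_spec: "p \<in> spec (coord_ring \<sigma>) \<Longrightarrow> frob_prime q \<sigma> p \<in> spec (coord_ring \<sigma>)"
  unfolding frob_prime_def
  by (rule spec_contraction[OF subring_coord_ring subring_coord_ring ring_hom_frob frob_coord_ring])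

lemma restrict_prime_spec:
  assumes "p \<in> spec (coord_ring \<tau>)" and "\<tau> \<subseteq> \<sigma>"
  shows "p \<inter> coord_ring \<sigma> \<in> spec (coord_ring \<sigma> :: ('i::{finite,linorder}, 'k::field) laurent set)"
proof -
  have "{f \<in> coord_ring \<sigma>. id f \<in> p} \<in> spec (coord_ring \<sigma>)"
    by (rule spec_contraction[OF subring_coord_ring subring_coord_ring _ _ assms(1)])
      (use coord_ring_antimono[OF assms(2)] in \<open>auto simp: ring_hom_fun_def\<close>)
  also have "{f \<in> coord_ring \<sigma>. id f \<in> p} = p \<inter> coord_ring \<sigma>" by auto
  finally show ?thesis .
qed

lemma cone_face_subset: "cone_face \<tau> \<sigma> \<Longrightarrow> \<tau> \<subseteq> \<sigma>"
  by (auto simp: cone_face_def face_of_def)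

lemma face_gluingE:
  assumes "(c, d) \<in> face_gluing \<Sigma>"
  obtains \<tau> \<sigma> p where "c = (\<tau>, p)" "d = (\<sigma>, p \<inter> coord_ring \<sigma>)" "\<tau> \<in> \<Sigma>" "\<sigma> \<in> \<Sigma>" "cone_face \<tau> \<sigma>"
    "p \<in> spec (coord_ring \<tau>)" "coord_ring \<sigma> \<subseteq> (coord_ring \<tau> :: ('i::{finite,linorder}, 'k::field) laurent set)"
    "c \<in> chart_points \<Sigma>" "d \<in> chart_points \<Sigma>"
proof -
  obtain \<tau> \<sigma> p where *: "c = (\<tau>, p)" "d = (\<sigma>, p \<inter> coord_ring \<sigma>)" "\<tau> \<in> \<Sigma>" "\<sigma> \<in> \<Sigma>" "cone_face \<tau> \<sigma>"
    "p \<in> spec (coord_ring \<tau>)"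
    using assms unfolding face_gluing_def by blast
  moreover have "c \<in> chart_points \<Sigma>" "d \<in> chart_points \<Sigma>"
    using * restrict_prime_spec[OF *(6)] cone_face_subset by (auto simp: chart_points_def)
  ultimately show ?thesis
    using that coord_ring_antimono[OF cone_face_subset] by blast
qed

lemma gluing_chart_points: "(c, d) \<in> gluing \<Sigma> \<Longrightarrow> c \<in> chart_points \<Sigma> \<and> d \<in> chart_points \<Sigma>"
  by (auto simp: gluing_def)

lemma point_of_eq_iff:
  "c \<in> chart_points \<Sigma> \<Longrightarrow> d \<in> chart_points \<Sigma> \<Longrightarrow> point_of \<Sigma> c = point_of \<Sigma> d \<longleftrightarrow> (c, d) \<in> gluing \<Sigma>"
  unfolding point_of_def by (rule eq_equiv_class_iff[OF equiv_gluing])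

text \<open>Contraction along \<open>frob q\<close> commutes with restriction to a face, because
  \<open>frob q\<close> maps the smaller coordinate ring into itself. The claim then follows along
  any chain of face gluings, in either direction.\<close>

lemma gluing_frob_prime:
  fixes \<Sigma> :: "(real ^ 'i::{finite,linorder}) set set" and c d :: "('i, 'k::field) chart_point"
  assumes "(c, d) \<in> gluing \<Sigma>"
  shows "((fst c, frob_prime q (fst c) (snd c)), (fst d, frob_prime q (fst d) (snd d))) \<in> gluing \<Sigma>"
proof -
  let ?\<Phi> = "\<lambda>c :: ('i, 'k) chart_point. (fst c, frob_prime q (fst c) (snd c))"
  have face: "(?\<Phi> c, ?\<Phi> d) \<in> face_gluing \<Sigma>" if "(c, d) \<in> face_gluing \<Sigma>" for c d
  proof -
    from that obtain \<tau> \<sigma> p where *: "c = (\<tau>, p)" "d = (\<sigma>, p \<inter> coord_ring \<sigma>)" "\<tau> \<in> \<Sigma>" "\<sigma> \<in> \<Sigma>"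
      "cone_face \<tau> \<sigma>" "p \<in> spec (coord_ring \<tau>)" "coord_ring \<sigma> \<subseteq> (coord_ring \<tau> :: ('i, 'k) laurent set)"
      by (rule face_gluingE)
    have "frob_prime q \<sigma> (p \<inter> coord_ring \<sigma>) = frob_prime q \<tau> p \<inter> coord_ring \<sigma>"
      using *(7) frob_coord_ring[of q \<sigma>] by (auto simp: frob_prime_def)
    then show ?thesis
      using * frob_prime_spec[OF *(6), of q] unfolding face_gluing_def by auto
  qed
  have "(?\<Phi> c, ?\<Phi> d) \<in> (face_gluing \<Sigma> \<union> (face_gluing \<Sigma>)\<inverse>)\<^sup>*"
  proof -
    have "(c, d) \<in> (face_gluing \<Sigma> \<union> (face_gluing \<Sigma>)\<inverse>)\<^sup>*"
      using assms by (simp add: gluing_def)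
    then show ?thesis
    proof (induction rule: rtrancl_induct)
      case (step y z)
      then have "(?\<Phi> y, ?\<Phi> z) \<in> face_gluing \<Sigma> \<union> (face_gluing \<Sigma>)\<inverse>"
        using face[of y z] face[of z y] by auto
      with step show ?case by (meson rtrancl.rtrancl_into_rtrancl)
    qed simp
  qed
  moreover have "?\<Phi> c \<in> chart_points \<Sigma>" "?\<Phi> d \<in> chart_points \<Sigma>"
    using gluing_chart_points[OF assms] by (auto simp: chart_points_def frob_prime_spec)
  ultimately show ?thesis by (simp add: gluing_def)
qed

text \<open>\<open>frob_point\<close> is a union over all representatives of a point; by
  \<open>gluing_frob_prime\<close> they all give the same class, so the union collapses.\<close>

lemma frob_point_point_of:
  assumes "(\<sigma>, p) \<in> chart_points \<Sigma>"
  shows "frob_point \<Sigma> q (point_of \<Sigma> (\<sigma>, p)) = point_of \<Sigma> (\<sigma>, frob_prime q \<sigma> p)"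
proof -
  have eq: "point_of \<Sigma> (\<tau>, {f \<in> coord_ring \<tau>. frob q f \<in> p'}) = point_of \<Sigma> (\<sigma>, frob_prime q \<sigma> p)"
    if "(\<tau>, p') \<in> point_of \<Sigma> (\<sigma>, p)" for \<tau> p'
  proof -
    have "((\<sigma>, p), (\<tau>, p')) \<in> gluing \<Sigma>"
      using that by (simp add: point_of_def)
    from gluing_frob_prime[OF this, of q]
    have g: "((\<sigma>, frob_prime q \<sigma> p), (\<tau>, frob_prime q \<tau> p')) \<in> gluing \<Sigma>"
      by simp
    then have "point_of \<Sigma> (\<sigma>, frob_prime q \<sigma> p) = point_of \<Sigma> (\<tau>, frob_prime q \<tau> p')"
      using gluing_chart_points[OF g] by (simp add: point_of_eq_iff)
    then show ?thesis by (simp add: frob_prime_def)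
  qed
  have "(\<sigma>, p) \<in> point_of \<Sigma> (\<sigma>, p)"
    unfolding point_of_def by (rule equiv_class_self[OF equiv_gluing assms])
  then show ?thesis
    unfolding frob_point_def using eq by fast
qed

lemma toric_open_nonempty:
  assumes "toric_open \<Sigma> U" "U \<noteq> {}"
  obtains \<sigma> p where "(\<sigma>, p) \<in> chart_points \<Sigma>" "point_of \<Sigma> (\<sigma>, p) \<in> U"
proof -
  obtain x where x: "x \<in> U" "x \<in> chart_points \<Sigma> // gluing \<Sigma>"
    using assms by (auto simp: toric_open_def toric_points_def)
  then show ?thesis
    using that unfolding point_of_def by (metis quotientE surj_pair)
qed

lemma point_of_toric_points: "c \<in> chart_points \<Sigma> \<Longrightarrow> point_of \<Sigma> c \<in> toric_points \<Sigma>"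
  unfolding point_of_def toric_points_def by (rule quotientI)

lemma point_of_frob_preimage:
  assumes "(\<sigma>, p) \<in> chart_points \<Sigma>"
  shows "point_of \<Sigma> (\<sigma>, p) \<in> frob_preimage \<Sigma> q U \<longleftrightarrow> point_of \<Sigma> (\<sigma>, frob_prime q \<sigma> p) \<in> U"
  using assms by (simp add: frob_preimage_def point_of_toric_points frob_point_point_of)

text \<open>The stalk of \<open>F\<^sub>*\<O>\<close> at \<open>p\<close> is the localisation at \<open>frob q ` (R - p)\<close>.\<close>

lemma sections_frob_preimage:
  fixes f :: "('i::{finite,linorder}, 'k::field) rational_function"
  assumes "q > 0" and f: "f \<in> sections \<Sigma> (frob_preimage \<Sigma> q U)"
    and c: "(\<sigma>, p) \<in> chart_points \<Sigma>" "point_of \<Sigma> (\<sigma>, p) \<in> U"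
  obtains a s where "a \<in> coord_ring \<sigma>" "s \<in> coord_ring \<sigma> - p" "s \<noteq> 0" "f = Fract a (frob q s)"
proof -
  have \<sigma>: "\<sigma> \<in> \<Sigma>" and p: "p \<in> spec (coord_ring \<sigma>)"
    using c by (auto simp: chart_points_def)
  \<comment> \<open>The primes of the chart over \<open>p\<close> are points of the preimage of
    \<open>U\<close>, so \<open>f\<close> is regular at each of them.\<close>
  have loc: "f \<in> local_ring (coord_ring \<sigma>) P"
    if "P \<in> spec (coord_ring \<sigma>)" "{g \<in> coord_ring \<sigma>. frob q g \<in> P} = p" for P
  proof -
    have "(\<sigma>, P) \<in> chart_points \<Sigma>" using \<sigma> that by (simp add: chart_points_def)
    moreover have "point_of \<Sigma> (\<sigma>, P) \<in> frob_preimage \<Sigma> q U"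
      unfolding point_of_frob_preimage[OF calculation] frob_prime_def that(2) by (rule c(2))
    ultimately show ?thesis using f by (auto simp: sections_def)
  qed
  obtain a s where "a \<in> coord_ring \<sigma>" "s \<in> coord_ring \<sigma> - p" "frob q s \<noteq> 0" "f = Fract a (frob q s)"
    using local_rings_over_prime[OF subring_coord_ring ring_hom_frob inj_frob[OF assms(1)] frob_coord_ring
        coord_ring_integral_over_frob[OF assms(1)] p loc] .
  moreover from this have "s \<noteq> 0"
    by (auto simp: ring_hom_funD[OF ring_hom_frob])
  ultimately show ?thesis using that by blast
qed

section \<open>Semilinear maps on fractions\<close>

lemma frob_eq_zero_iff:
  fixes f :: "('i::linorder, 'k::field) laurent"
  shows "q > 0 \<Longrightarrow> frob q f = 0 \<longleftrightarrow> f = 0"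
  using inj_eq[OF inj_frob, of q f 0] by (simp add: ring_hom_funD(1)[OF ring_hom_frob])

lemma frob_fract_Fract:
  assumes "q > 0" "b \<noteq> 0"
  shows "frob_fract q (Fract a b) = Fract (frob q a) (frob q b)"
  unfolding frob_fract_def map_fract_def
proof (rule the_equality)
  show "\<exists>a' b'. b' \<noteq> 0 \<and> Fract a b = Fract a' b' \<and> Fract (frob q a) (frob q b) = Fract (frob q a') (frob q b')"
    using assms by blast
  fix g
  assume "\<exists>a' b'. b' \<noteq> 0 \<and> Fract a b = Fract a' b' \<and> g = Fract (frob q a') (frob q b')"
  then obtain a' b' where *: "b' \<noteq> 0" "Fract a b = Fract a' b'" "g = Fract (frob q a') (frob q b')"
    by blast
  then have "frob q (a * b') = frob q (a' * b)"
    using assms by (simp add: eq_fract)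
  then show "g = Fract (frob q a) (frob q b)"
    using * assms by (simp add: eq_fract frob_eq_zero_iff ring_hom_funD[OF ring_hom_frob])
qed

text \<open>Meant for fractions with denominator in the image of \<open>frob q\<close>; by
  \<open>sections_frob_preimage\<close>, sections over the preimage of a nonempty open set have this
  form.\<close>

definition frac_ext ::
    "nat \<Rightarrow> (('i::linorder \<Rightarrow>\<^sub>0 int) \<Rightarrow> ('i, 'k::field) laurent)
      \<Rightarrow> ('i, 'k) rational_function \<Rightarrow> ('i, 'k) rational_function" where
  "frac_ext q g f = (THE y. \<exists>a s. s \<noteq> 0 \<and> f = Fract a (frob q s) \<and> y = Fract (lin_ext g a) s)"

text \<open>The value does not depend on the fraction: cross-multiplication gives
  \<open>frob q s' * a = frob q s * a'\<close>, and semilinearity turns this into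
  \<open>s' * lin_ext g a = s * lin_ext g a'\<close>.\<close>

lemma frac_ext_Fract:
  assumes "q > 0" "frob_equivariant q g" "s \<noteq> 0"
  shows "frac_ext q g (Fract a (frob q s)) = Fract (lin_ext g a) s"
  unfolding frac_ext_def
proof (rule the_equality)
  show "\<exists>a' s'. s' \<noteq> 0 \<and> Fract a (frob q s) = Fract a' (frob q s') \<and>
      Fract (lin_ext g a) s = Fract (lin_ext g a') s'"
    using assms by blast
  fix y
  assume "\<exists>a' s'. s' \<noteq> 0 \<and> Fract a (frob q s) = Fract a' (frob q s') \<and> y = Fract (lin_ext g a') s'"
  then obtain a' s' where *: "s' \<noteq> 0" "Fract a (frob q s) = Fract a' (frob q s')" "y = Fract (lin_ext g a') s'"
    by blast
  then have "frob q s' * a = frob q s * a'"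
    using assms by (simp add: eq_fract frob_eq_zero_iff mult.commute)
  then have "s' * lin_ext g a = s * lin_ext g a'"
    using lin_ext_frob_mult[OF assms(2)] by metis
  then show "y = Fract (lin_ext g a) s"
    using * assms by (simp add: eq_fract mult.commute)
qed

text \<open>Restrictions of sections are inclusions, so one map of rational functions serves all
  open sets. It preserves regularity at \<open>p\<close>: for \<open>s\<close> outside
  \<open>p\<close>, the fraction of \<open>a\<close> by \<open>frob q s\<close> goes to that of
  \<open>lin_ext g a\<close> by the same \<open>s\<close>, and \<open>pres\<close> keeps the
  numerator in the chart.\<close>

lemma splitting_frac_ext:
  fixes \<Sigma> :: "(real ^ 'i::{finite,linorder}) set set"
    and g :: "('i \<Rightarrow>\<^sub>0 int) \<Rightarrow> ('i, 'k::field) laurent"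
  assumes q: "q > 0" and g: "frob_equivariant q g"
    and pres: "\<And>\<sigma> u. \<sigma> \<in> \<Sigma> \<Longrightarrow> u \<in> dual_monoid \<sigma> \<Longrightarrow> g u \<in> coord_ring \<sigma>"
  shows "splitting \<Sigma> q (\<lambda>U. frac_ext q g)"
proof -
  note ext = frac_ext_Fract[OF q g]
  \<comment> \<open>A point of the nonempty \<open>U\<close> supplies the chart in which
    \<open>f\<close> can be written this way.\<close>
  have form: "\<exists>a s. s \<noteq> 0 \<and> f = Fract a (frob q s)"
    if "toric_open \<Sigma> U" "U \<noteq> {}" "f \<in> sections \<Sigma> (frob_preimage \<Sigma> q U)"
    for U and f :: "('i, 'k) rational_function"
    using toric_open_nonempty[OF that(1,2)] sections_frob_preimage[OF q that(3)] by metis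
  have "frac_ext q g f \<in> sections \<Sigma> U" if f: "f \<in> sections \<Sigma> (frob_preimage \<Sigma> q U)" for U f
  proof -
    have "frac_ext q g f \<in> local_ring (coord_ring \<sigma>) p"
      if c: "(\<sigma>, p) \<in> chart_points \<Sigma>" "point_of \<Sigma> (\<sigma>, p) \<in> U" for \<sigma> p
    proof -
      obtain a s where *: "a \<in> coord_ring \<sigma>" "s \<in> coord_ring \<sigma> - p" "s \<noteq> 0" "f = Fract a (frob q s)"
        using sections_frob_preimage[OF q f c] .
      moreover have "lin_ext g a \<in> coord_ring \<sigma>"
        using c pres * by (intro lin_ext_coord_ring) (auto simp: chart_points_def)
      ultimately show ?thesis by (auto simp: ext local_ring_def)
    qed
    then show ?thesis by (auto simp: sections_def)
  qed
  moreover have "frac_ext q g (f + f') = frac_ext q g f + frac_ext q g f'"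
    if sec: "toric_open \<Sigma> U" "U \<noteq> {}" "f \<in> sections \<Sigma> (frob_preimage \<Sigma> q U)"
      "f' \<in> sections \<Sigma> (frob_preimage \<Sigma> q U)" for U f f'
  proof -
    obtain a s b t where *: "s \<noteq> 0" "f = Fract a (frob q s)" "t \<noteq> 0" "f' = Fract b (frob q t)"
      using form[OF sec(1,2,3)] form[OF sec(1,2,4)] by blast
    then have "f + f' = Fract (frob q t * a + frob q s * b) (frob q (s * t))"
      using q by (simp add: frob_eq_zero_iff ring_hom_funD[OF ring_hom_frob] mult.commute)
    also have "frac_ext q g \<dots> = Fract (t * lin_ext g a + s * lin_ext g b) (s * t)"
      using * by (subst ext) (simp_all add: lin_ext_add lin_ext_frob_mult[OF g])
    also have "\<dots> = frac_ext q g f + frac_ext q g f'"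
      using * by (simp add: ext mult.commute)
    finally show ?thesis .
  qed
  moreover have "frac_ext q g (frob_fract q x * f) = x * frac_ext q g f"
    if sec: "toric_open \<Sigma> U" "U \<noteq> {}" "f \<in> sections \<Sigma> (frob_preimage \<Sigma> q U)" for U f x
  proof -
    obtain b t where *: "t \<noteq> 0" "f = Fract b (frob q t)"
      using form[OF sec] by blast
    obtain a s where x: "x = Fract a s" "s \<noteq> 0"
      by (cases x)
    then have "frob_fract q x * f = Fract (frob q a * b) (frob q (s * t))"
      using q * by (simp add: frob_fract_Fract ring_hom_funD[OF ring_hom_frob])
    then show ?thesis
      using * x by (simp add: ext lin_ext_frob_mult[OF g])
  qed
  moreover have "frac_ext q g (frob_fract q x) = x" for x
  proof -
    obtain a s where x: "x = Fract a s" "s \<noteq> 0"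
      by (cases x)
    then show ?thesis
      by (simp add: frob_fract_Fract[OF q] ext lin_ext_frob[OF g])
  qed
  ultimately show ?thesis
    unfolding splitting_def sheaf_module_map_def by (intro conjI allI impI ballI refl; elim conjE; blast)
qed

section \<open>Compatibility with the diagonal\<close>

text \<open>Regularity on the chart of the larger cone writes \<open>f\<close> as \<open>a\<close>
  over \<open>b\<close> in the smaller ring, with \<open>b\<close> outside \<open>p\<close>. If
  \<open>f\<close> is also \<open>a'\<close> over \<open>b'\<close> with \<open>a'\<close> in
  \<open>p\<close>, then \<open>a * b' = b * a'\<close> and primality force \<open>a\<close> into
  \<open>p\<close>. The converse is an inclusion.\<close>

lemma ideal_gluing_step:
  fixes f :: "('i::{finite,linorder}, 'k::field) rational_function"
  assumes "(c, d) \<in> face_gluing \<Sigma>"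
    and "f \<in> local_ring (coord_ring (fst c)) (snd c)" "f \<in> local_ring (coord_ring (fst d)) (snd d)"
  shows "f \<in> local_max_ideal (coord_ring (fst c)) (snd c) \<longleftrightarrow> f \<in> local_max_ideal (coord_ring (fst d)) (snd d)"
proof -
  from assms(1) obtain \<tau> \<sigma> p where *: "c = (\<tau>, p)" "d = (\<sigma>, p \<inter> coord_ring \<sigma>)"
    "p \<in> spec (coord_ring \<tau>)" "coord_ring \<sigma> \<subseteq> (coord_ring \<tau> :: ('i, 'k) laurent set)"
    by (rule face_gluingE)
  note pD = *(3)[unfolded spec_iff[OF subring_coord_ring]]
  note pI = ideal_setD[OF conjunct1[OF pD]]
  show ?thesis
  proof
    assume "f \<in> local_max_ideal (coord_ring (fst c)) (snd c)"
    then obtain a' b' where 1: "f = Fract a' b'" "a' \<in> p" "b' \<in> coord_ring \<tau>" "b' \<notin> p"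
      by (auto simp: local_max_ideal_def *)
    obtain a b where 2: "f = Fract a b" "a \<in> coord_ring \<sigma>" "b \<in> coord_ring \<sigma>" "b \<notin> p"
      using assms(3) by (auto simp: local_ring_def *)
    have "b \<noteq> 0" "b' \<noteq> 0" using 1 2 pI(2) by auto
    then have "a * b' = b * a'"
      using 1 2 by (simp add: eq_fract mult.commute)
    also have "\<dots> \<in> p" using pI(4) 1 2 *(4) by blast
    finally have "a \<in> p" using pD 1 2 *(4) by blast
    then show "f \<in> local_max_ideal (coord_ring (fst d)) (snd d)"
      using 2 by (auto simp: local_max_ideal_def *)
  next
    assume "f \<in> local_max_ideal (coord_ring (fst d)) (snd d)"
    then obtain a b where "f = Fract a b" "a \<in> p" "b \<in> coord_ring \<sigma>" "b \<notin> p"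
      by (auto simp: local_max_ideal_def *)
    then show "f \<in> local_max_ideal (coord_ring (fst c)) (snd c)"
      using *(4) unfolding local_max_ideal_def by (auto simp: *(1))
  qed
qed

text \<open>\<open>ideal_sections\<close> quantifies over all representatives of a point; this lets
  vanishing be checked at one. The regularity that each gluing step needs holds because the
  intermediate representatives give the same point of \<open>U\<close>.\<close>

lemma ideal_gluing:
  fixes f :: "('i::{finite,linorder}, 'k::field) rational_function"
  assumes "(c, d) \<in> gluing \<Sigma>" and f: "f \<in> sections \<Sigma> U" and c: "point_of \<Sigma> c \<in> U"
    and "f \<in> local_max_ideal (coord_ring (fst c)) (snd c)"
  shows "f \<in> local_max_ideal (coord_ring (fst d)) (snd d)"
proof -
  have cc: "c \<in> chart_points \<Sigma>" and "(c, d) \<in> (face_gluing \<Sigma> \<union> (face_gluing \<Sigma>)\<inverse>)\<^sup>*"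
    using assms(1) by (auto simp: gluing_def)
  have loc: "f \<in> local_ring (coord_ring (fst y)) (snd y)" if "(c, y) \<in> gluing \<Sigma>" for y
  proof -
    have y: "y \<in> chart_points \<Sigma>" using gluing_chart_points[OF that] by simp
    then have "point_of \<Sigma> y \<in> U"
      using point_of_eq_iff[OF cc y] that c by simp
    then show ?thesis using y f by (auto simp: sections_def split: prod.splits)
  qed
  from \<open>(c, d) \<in> (_)\<^sup>*\<close> have "(c, d) \<in> gluing \<Sigma> \<and> f \<in> local_max_ideal (coord_ring (fst d)) (snd d)"
  proof (induction rule: rtrancl_induct)
    case base
    then show ?case using assms(4) cc by (simp add: gluing_def)
  next
    case (step y z)
    have "z \<in> chart_points \<Sigma>"
      using step.hyps(2) by (auto elim: face_gluingE)
    then have cz: "(c, z) \<in> gluing \<Sigma>"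
      using cc rtrancl.rtrancl_into_rtrancl[OF step.hyps] by (simp add: gluing_def)
    from step.hyps(2) have "f \<in> local_max_ideal (coord_ring (fst z)) (snd z)"
    proof
      assume "(y, z) \<in> face_gluing \<Sigma>"
      from ideal_gluing_step[OF this loc loc] show ?thesis using step.IH cz by simp
    next
      assume "(y, z) \<in> (face_gluing \<Sigma>)\<inverse>"
      then have "(z, y) \<in> face_gluing \<Sigma>" by simp
      from ideal_gluing_step[OF this loc loc] show ?thesis using step.IH cz by simp
    qed
    with cz show ?case by simp
  qed
  then show ?thesis by simp
qed

section \<open>Product cones and the comorphism of the diagonal\<close>

definition join_vec :: "real ^ 'i::finite \<Rightarrow> real ^ 'j::finite \<Rightarrow> real ^ ('i + 'j)" where
  "join_vec x y = (\<chi> k. case k of Inl i \<Rightarrow> x $ i | Inr j \<Rightarrow> y $ j)"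

lemma join_vec_in_product_cone: "join_vec x y \<in> product_cone \<sigma> \<tau> \<longleftrightarrow> x \<in> \<sigma> \<and> y \<in> \<tau>"
  by (simp add: product_cone_def join_vec_def)

lemma lookup_map_key: "inj \<iota> \<Longrightarrow> Poly_Mapping.lookup (Poly_Mapping.map_key \<iota> w) i = Poly_Mapping.lookup w (\<iota> i)"
  by (simp add: map_key.rep_eq)

lemma lookup_codiagonal:
  "Poly_Mapping.lookup (codiagonal w) i = Poly_Mapping.lookup w (Inl i) + Poly_Mapping.lookup w (Inr i)"
  by (simp add: codiagonal_def lookup_add lookup_map_key)

lemma pairing_sum:
  fixes w :: "'i::finite + 'j::finite \<Rightarrow>\<^sub>0 int"
  shows "pairing w x = pairing (Poly_Mapping.map_key Inl w) (\<chi> i. x $ Inl i)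
    + pairing (Poly_Mapping.map_key Inr w) (\<chi> j. x $ Inr j)"
  by (simp add: pairing_def lookup_map_key UNIV_Plus_UNIV[symmetric] sum.Plus del: UNIV_Plus_UNIV)

text \<open>Testing \<open>w\<close> on pairs (x, 0) and (0, y) separates the two factors; this is
  where 0 must lie in both cones.\<close>

lemma dual_monoid_product_cone:
  assumes "0 \<in> \<sigma>" "0 \<in> \<tau>"
  shows "w \<in> dual_monoid (product_cone \<sigma> \<tau>) \<longleftrightarrow>
    Poly_Mapping.map_key Inl w \<in> dual_monoid \<sigma> \<and> Poly_Mapping.map_key Inr w \<in> dual_monoid \<tau>"
proof
  assume w: "w \<in> dual_monoid (product_cone \<sigma> \<tau>)"
  have "0 \<le> pairing w (join_vec x y)" if "x \<in> \<sigma>" "y \<in> \<tau>" for x y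
    using w that by (simp add: dual_monoid_def join_vec_in_product_cone)
  then have *: "0 \<le> pairing (Poly_Mapping.map_key Inl w) x + pairing (Poly_Mapping.map_key Inr w) y"
    if "x \<in> \<sigma>" "y \<in> \<tau>" for x y
    using that unfolding pairing_sum by (simp add: join_vec_def)
  show "Poly_Mapping.map_key Inl w \<in> dual_monoid \<sigma> \<and> Poly_Mapping.map_key Inr w \<in> dual_monoid \<tau>"
    using *[OF _ assms(2)] *[OF assms(1)] by (auto simp: dual_monoid_def)
qed (auto simp: dual_monoid_def product_cone_def pairing_sum[of w])

lemma codiagonal_zero: "codiagonal 0 = 0"
  by (simp add: codiagonal_def)

lemma codiagonal_add: "codiagonal (u + v) = codiagonal u + codiagonal v"
  by (rule poly_mapping_eqI) (simp add: lookup_codiagonal lookup_add)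

lemma codiagonal_scale: "codiagonal (scale q u) = scale q (codiagonal u)"
  by (rule poly_mapping_eqI) (simp add: lookup_codiagonal distrib_left)

abbreviation comult :: "('i::linorder + 'i, 'k::field) laurent \<Rightarrow> ('i, 'k) laurent" where
  "comult \<equiv> monomial_map codiagonal"

lemma ring_hom_comult: "ring_hom_fun comult"
  by (rule ring_hom_monomial_map[OF codiagonal_zero codiagonal_add])

lemma comult_frob: "comult (frob q f) = frob q (comult f)"
proof (induction f rule: poly_mapping_induct_add)
  case (single u c)
  show ?case by (simp add: codiagonal_scale)
next
  case (add f g)
  then show ?case by (simp add: monomial_map_add ring_hom_funD(3)[OF ring_hom_frob])
qed

lemma comult_coord_ring: "comult ` coord_ring (product_cone \<sigma> \<sigma>) \<subseteq> coord_ring \<sigma>"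
proof -
  have "codiagonal w \<in> dual_monoid \<sigma>" if w: "w \<in> dual_monoid (product_cone \<sigma> \<sigma>)" for w
    unfolding dual_monoid_def
  proof (intro CollectI ballI)
    fix x assume "x \<in> \<sigma>"
    then have "0 \<le> pairing w (join_vec x x)"
      using w by (simp add: dual_monoid_def join_vec_in_product_cone)
    then show "0 \<le> pairing (codiagonal w) x"
      unfolding pairing_sum by (simp add: join_vec_def codiagonal_def pairing_add)
  qed
  then show ?thesis
    unfolding monomial_map_lin_ext
    by (intro image_subsetI lin_ext_coord_ring single_in_coord_ring) auto
qed

lemma zero_spec: "{0} \<in> spec (coord_ring \<sigma> :: ('i::{finite,linorder}, 'k::field) laurent set)"
  unfolding spec_iff[OF subring_coord_ring] by (auto simp: ideal_set_def coord_ringD)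

text \<open>By \<open>comm\<close>, \<open>lin_ext g\<close> maps the kernel of
  \<open>comult\<close> into itself. It remains to see that, at a point of the diagonal, the
  numerator of a section of the ideal lies in this kernel and not merely in the prime of that
  point.\<close>

lemma compatible_with_diagonal:
  fixes \<Sigma> :: "(real ^ 'i::{finite,linorder}) set set"
    and g :: "('i + 'i \<Rightarrow>\<^sub>0 int) \<Rightarrow> ('i + 'i, 'k::field) laurent"
  assumes q: "q > 0" and g: "frob_equivariant q g"
    and pres: "\<And>\<sigma> u. \<sigma> \<in> product_fan \<Sigma> \<Sigma> \<Longrightarrow> u \<in> dual_monoid \<sigma> \<Longrightarrow> g u \<in> coord_ring \<sigma>"
    and comm: "\<And>w. comult (g w) = g' (codiagonal w)"
  shows "compatible_with (product_fan \<Sigma> \<Sigma>) q (\<lambda>U. frac_ext q g) (diagonal \<Sigma>)"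
  unfolding compatible_with_def
proof (intro allI impI subsetI)
  let ?P = "product_fan \<Sigma> \<Sigma>"
  fix U y
  assume U: "toric_open ?P U \<and> U \<noteq> {}"
    and "y \<in> frac_ext q g ` ideal_sections ?P (diagonal \<Sigma>) (frob_preimage ?P q U)"
  then obtain f where y: "y = frac_ext q g f"
    and fI: "f \<in> ideal_sections ?P (diagonal \<Sigma>) (frob_preimage ?P q U)" by blast
  have f: "f \<in> sections ?P (frob_preimage ?P q U)"
    using fI by (simp add: ideal_sections_def)
  have yU: "y \<in> sections ?P U"
    using splitting_frac_ext[OF q g pres] U f by (simp add: splitting_def sheaf_module_map_def y)
  have "y \<in> local_max_ideal (coord_ring \<rho>) p"
    if c: "(\<rho>, p) \<in> chart_points ?P" "point_of ?P (\<rho>, p) \<in> U \<inter> diagonal \<Sigma>" for \<rho> p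
  proof -
    obtain \<sigma> p0 where p0: "(\<sigma>, p0) \<in> chart_points \<Sigma>" and eq: "point_of ?P (\<rho>, p) =
        point_of ?P (product_cone \<sigma> \<sigma>, {f \<in> coord_ring (product_cone \<sigma> \<sigma>). comult f \<in> p0})"
      using c(2) by (auto simp: diagonal_def)
    define \<sigma>\<sigma> where "\<sigma>\<sigma> = product_cone \<sigma> \<sigma>"
    define R where "R = (coord_ring \<sigma>\<sigma> :: ('i + 'i, 'k) laurent set)"
    define p1 where "p1 = {f \<in> R. comult f \<in> p0}"
    \<comment> \<open>the generic point of the diagonal\<close>
    define \<eta> where "\<eta> = {f \<in> R. comult f \<in> {0}}"
    have \<sigma>: "\<sigma> \<in> \<Sigma>" "p0 \<in> spec (coord_ring \<sigma>)"
      using p0 by (auto simp: chart_points_def)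
    have \<sigma>\<sigma>: "\<sigma>\<sigma> \<in> ?P" using \<sigma> by (auto simp: \<sigma>\<sigma>_def product_fan_def)
    note contr = spec_contraction[OF subring_coord_ring subring_coord_ring ring_hom_comult comult_coord_ring]
    have specs: "p1 \<in> spec R" "\<eta> \<in> spec R"
      unfolding p1_def \<eta>_def R_def \<sigma>\<sigma>_def using contr[OF \<sigma>(2)] contr[OF zero_spec] by auto
    then have charts: "(\<sigma>\<sigma>, p1) \<in> chart_points ?P" "(\<sigma>\<sigma>, \<eta>) \<in> chart_points ?P"
      using \<sigma>\<sigma> by (auto simp: chart_points_def R_def)
    have zero_p0: "0 \<in> p0"
      using \<sigma>(2) spec_iff[OF subring_coord_ring] ideal_setD(2) by blast
    have p1U: "point_of ?P (\<sigma>\<sigma>, p1) \<in> U"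
      using eq c(2) by (simp add: p1_def R_def \<sigma>\<sigma>_def)
    \<comment> \<open>Open sets are stable under generization: a set \<open>E\<close> that is not
      inside \<open>p1\<close> is not inside the smaller prime \<open>\<eta>\<close>.\<close>
    have \<eta>U: "point_of ?P (\<sigma>\<sigma>, \<eta>) \<in> U"
    proof -
      obtain E where E: "{p \<in> spec R. point_of ?P (\<sigma>\<sigma>, p) \<in> U} = {p \<in> spec R. \<not> E \<subseteq> p}"
        using U \<sigma>\<sigma> unfolding toric_open_def zariski_open_def R_def by blast
      have "\<not> E \<subseteq> p1" using E specs p1U by blast
      moreover have "\<eta> \<subseteq> p1" using zero_p0 by (auto simp: \<eta>_def p1_def)
      ultimately show ?thesis using E specs by blast
    qed
    \<comment> \<open>F fixes the generic point of the diagonal, since \<open>comult\<close>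
      commutes with the injective map \<open>frob q\<close>. Hence this point also lies in the
      preimage of \<open>U\<close>, where the hypothesis on \<open>f\<close> applies.\<close>
    have "frob_prime q \<sigma>\<sigma> \<eta> = \<eta>"
      using frob_coord_ring[of q \<sigma>\<sigma>] q
      by (auto simp: frob_prime_def \<eta>_def R_def comult_frob frob_eq_zero_iff)
    then have "point_of ?P (\<sigma>\<sigma>, \<eta>) \<in> frob_preimage ?P q U"
      using point_of_frob_preimage[OF charts(2)] \<eta>U by simp
    moreover have "point_of ?P (\<sigma>\<sigma>, \<eta>) \<in> diagonal \<Sigma>"
      unfolding diagonal_def \<eta>_def R_def \<sigma>\<sigma>_def
      using \<sigma> zero_spec[of \<sigma>] by (intro CollectI exI[of _ \<sigma>] exI[of _ "{0}"]) (simp add: chart_points_def)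
    ultimately have "f \<in> local_max_ideal R \<eta>"
      using fI charts(2) by (auto simp: ideal_sections_def R_def)
    then obtain a' b' where 1: "f = Fract a' b'" "a' \<in> \<eta>" "b' \<in> R" "b' \<notin> \<eta>"
      by (auto simp: local_max_ideal_def)
    obtain a s where 2: "a \<in> R" "s \<in> R - p1" "s \<noteq> 0" "f = Fract a (frob q s)"
      unfolding R_def using sections_frob_preimage[OF q f charts(1) p1U] .
    have "b' \<noteq> 0" using 1 by (auto simp: \<eta>_def ring_hom_funD(1)[OF ring_hom_comult])
    then have "a * b' = a' * frob q s"
      using 1 2 q by (simp add: eq_fract frob_eq_zero_iff)
    then have "comult a * comult b' = comult a' * comult (frob q s)"
      by (metis ring_hom_funD(4)[OF ring_hom_comult])
    \<comment> \<open>\<open>comult a'\<close> is 0, while \<open>comult b'\<close> is not, as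
      \<open>b'\<close> lies outside \<open>\<eta>\<close>; k[M] is a domain.\<close>
    then have "comult a = 0"
      using 1 by (auto simp: \<eta>_def)
    moreover have "comult (lin_ext g a) = lin_ext g' (comult a)"
      by (simp add: monomial_map_lin_ext_comp codiagonal_zero codiagonal_add lin_ext_monomial_map
          comp_def comm)
    moreover have "lin_ext g a \<in> R"
      using 2 pres[OF \<sigma>\<sigma>] unfolding R_def by (intro lin_ext_coord_ring)
    ultimately have "lin_ext g a \<in> p1"
      using zero_p0 by (simp add: p1_def)
    then have "y \<in> local_max_ideal R p1"
      using 2 by (auto simp: y frac_ext_Fract[OF q g] local_max_ideal_def)
    moreover have "((\<sigma>\<sigma>, p1), (\<rho>, p)) \<in> gluing ?P"
      using point_of_eq_iff[OF charts(1) c(1)] eq by (simp add: p1_def R_def \<sigma>\<sigma>_def)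
    ultimately show ?thesis
      using ideal_gluing[OF _ yU p1U, of "(\<rho>, p)"] by (simp add: R_def)
  qed
  then show "y \<in> ideal_sections ?P (diagonal \<Sigma>) U"
    using yU by (auto simp: ideal_sections_def)
qed

section \<open>Cones generated by rays\<close>

lemma convex_cone_hull_finite:
  fixes G :: "'a::real_vector set"
  assumes "finite G"
  shows "convex_cone hull G = {\<Sum>g\<in>G. c g *\<^sub>R g | c. \<forall>g\<in>G. 0 \<le> c g}"
proof
  let ?S = "{\<Sum>g\<in>G. c g *\<^sub>R g | c. \<forall>g\<in>G. 0 \<le> c g}"
  show "convex_cone hull G \<subseteq> ?S"
  proof (rule hull_minimal)
    show "G \<subseteq> ?S"
    proof
      fix h assume "h \<in> G"
      then have "(\<Sum>g\<in>G. (if g = h then 1 else 0) *\<^sub>R g) = h"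
        using assms by (simp add: if_distrib[of "\<lambda>c. c *\<^sub>R _"] cong: if_cong)
      then show "h \<in> ?S" by (intro CollectI exI[of _ "\<lambda>g. if g = h then 1 else 0"]) auto
    qed
    show "convex_cone ?S"
      unfolding convex_cone_iff
    proof (intro conjI ballI allI impI)
      show "0 \<in> ?S" by (intro CollectI exI[of _ "\<lambda>_. 0"]) auto
      fix x assume "x \<in> ?S"
      then obtain c where c: "x = (\<Sum>g\<in>G. c g *\<^sub>R g)" "\<forall>g\<in>G. 0 \<le> c g" by auto
      show "t *\<^sub>R x \<in> ?S" if "0 \<le> t" for t
        using c that by (intro CollectI exI[of _ "\<lambda>g. t * c g"]) (auto simp: scaleR_sum_right)
      fix y assume "y \<in> ?S"
      then obtain d where "y = (\<Sum>g\<in>G. d g *\<^sub>R g)" "\<forall>g\<in>G. 0 \<le> d g" by auto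
      with c show "x + y \<in> ?S"
        by (intro CollectI exI[of _ "\<lambda>g. c g + d g"]) (auto simp: scaleR_add_left sum.distrib)
    qed
  qed
  have "(\<Sum>g\<in>H. c g *\<^sub>R g) \<in> convex_cone hull G" if "finite H" "H \<subseteq> G" "\<forall>g\<in>G. 0 \<le> c g" for H c
    using that
  proof (induction H rule: finite_induct)
    case empty
    then show ?case by (simp add: convex_cone_hull_contains_0)
  next
    case (insert h H)
    then show ?case by (simp add: convex_cone_hull_add convex_cone_hull_mul hull_inc)
  qed
  then show "?S \<subseteq> convex_cone hull G" using assms by blast
qed

lemma convex_cone_hull_singleton: "convex_cone hull {g} = {c *\<^sub>R g | c. 0 \<le> c}"
  by (simp add: convex_cone_hull_finite) (force intro: exI[of _ "\<lambda>_. c" for c])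

lemma minimal_cone_generators:
  fixes G :: "'a::real_vector set"
  assumes "finite G"
  obtains H where "H \<subseteq> G" "convex_cone hull H = convex_cone hull G"
    "\<And>h. h \<in> H \<Longrightarrow> h \<notin> convex_cone hull (H - {h})"
proof -
  have "\<exists>H\<subseteq>G. convex_cone hull H = convex_cone hull G \<and> (\<forall>h\<in>H. h \<notin> convex_cone hull (H - {h}))"
    using assms
  proof (induction G rule: finite_psubset_induct)
    case (psubset G)
    show ?case
    proof (cases "\<exists>h\<in>G. h \<in> convex_cone hull (G - {h})")
      case True
      then obtain h where h: "h \<in> G" "h \<in> convex_cone hull (G - {h})" by blast
      then have "convex_cone hull (G - {h}) = convex_cone hull G"
        using hull_redundant[OF h(2)] by (simp add: insert_absorb)
      moreover have "G - {h} \<subset> G" using h by blast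
      ultimately show ?thesis using psubset.IH[of "G - {h}"] by blast
    qed blast
  qed
  then show ?thesis using that by blast
qed

text \<open>Suppose a proper convex combination of two points of the cone lies on the ray of
  \<open>g\<close>. Moving the terms in \<open>g\<close> to one side leaves \<open>r\<close>, a
  nonnegative combination of the other generators, equal to a multiple of \<open>g\<close>. A
  positive multiple would make \<open>g\<close> redundant; otherwise \<open>- r\<close> is in the
  cone as well, and pointedness gives \<open>r = 0\<close>.\<close>

lemma minimal_generator_spans_face:
  fixes H :: "(real ^ 'i::finite) set"
  assumes H: "finite H" and sc: "strongly_convex (convex_cone hull H)"
    and min: "\<And>h. h \<in> H \<Longrightarrow> h \<notin> convex_cone hull (H - {h})" and g: "g \<in> H"
  shows "cone_face (convex_cone hull {g}) (convex_cone hull H)"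
proof -
  let ?K = "convex_cone hull H"
  note add = convex_cone_hull_add and mul = convex_cone_hull_mul
  have pointed: "x = 0" if "x \<in> ?K" "- x \<in> ?K" for x
  proof -
    have "x \<in> ?K \<inter> uminus ` ?K" using that by (metis IntI image_eqI minus_minus)
    then show ?thesis using sc by (auto simp: strongly_convex_def)
  qed
  have partial: "(\<Sum>h\<in>A. c h *\<^sub>R h) \<in> convex_cone hull A" if "finite A" "\<forall>h\<in>A. 0 \<le> c h" for A c
    using that unfolding convex_cone_hull_finite[OF that(1)] by blast
  have mono: "convex_cone hull A \<subseteq> ?K" if "A \<subseteq> H" for A
    using that by (rule hull_mono)
  have face: "a \<in> convex_cone hull {g} \<and> b \<in> convex_cone hull {g}"
    if "a \<in> ?K" "b \<in> ?K" and x: "x \<in> convex_cone hull {g}" "x \<in> open_segment a b" for a b x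
  proof -
    obtain \<alpha> where \<alpha>: "a = (\<Sum>h\<in>H. \<alpha> h *\<^sub>R h)" "\<And>h. h \<in> H \<Longrightarrow> 0 \<le> \<alpha> h"
      using \<open>a \<in> ?K\<close> unfolding convex_cone_hull_finite[OF H] by blast
    obtain \<beta> where \<beta>: "b = (\<Sum>h\<in>H. \<beta> h *\<^sub>R h)" "\<And>h. h \<in> H \<Longrightarrow> 0 \<le> \<beta> h"
      using \<open>b \<in> ?K\<close> unfolding convex_cone_hull_finite[OF H] by blast
    obtain t where t: "0 < t" "t < 1" "x = (1 - t) *\<^sub>R a + t *\<^sub>R b"
      using x(2) by (auto simp: in_segment)
    obtain c where c: "0 \<le> c" "x = c *\<^sub>R g"
      using x(1) by (auto simp: convex_cone_hull_singleton)
    define \<gamma> where "\<gamma> h = (1 - t) * \<alpha> h + t * \<beta> h" for h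
    have \<gamma>0: "0 \<le> \<gamma> h" if "h \<in> H" for h
      using \<alpha>(2)[OF that] \<beta>(2)[OF that] t by (simp add: \<gamma>_def)
    define r where "r = (\<Sum>h\<in>H - {g}. \<gamma> h *\<^sub>R h)"
    have "c *\<^sub>R g = (\<Sum>h\<in>H. \<gamma> h *\<^sub>R h)"
      using c t by (simp add: \<alpha> \<beta> \<gamma>_def scaleR_sum_right scaleR_add_left sum.distrib)
    also have "\<dots> = \<gamma> g *\<^sub>R g + r"
      unfolding r_def by (rule sum.remove[OF H g])
    finally have r: "r = (c - \<gamma> g) *\<^sub>R g" by (simp add: scaleR_diff_left)
    have rH: "r \<in> convex_cone hull (H - {g})"
      unfolding r_def using H \<gamma>0 by (intro partial) auto
    have "\<not> c > \<gamma> g"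
    proof
      assume "c > \<gamma> g"
      then have "g = (1 / (c - \<gamma> g)) *\<^sub>R r" by (simp add: r)
      then have "g \<in> convex_cone hull (H - {g})"
        using mul[OF rH, of "1 / (c - \<gamma> g)"] \<open>c > \<gamma> g\<close> by simp
      then show False using min[OF g] by blast
    qed
    then have "- r \<in> ?K"
      using mul[of g H "\<gamma> g - c"] hull_inc[OF g] by (simp add: r scaleR_diff_left)
    then have "r = 0" using pointed rH mono[of "H - {g}"] by blast
    \<comment> \<open>Each term of the vanishing sum is the negative of the rest, hence zero by
      pointedness. Minimality excludes \<open>h = 0\<close>, so the coefficient vanishes.\<close>
    have zero: "\<gamma> h = 0" if h: "h \<in> H - {g}" for h
    proof -
      have "h \<noteq> 0" using min[of h] convex_cone_hull_contains_0 h by blast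
      have "r = \<gamma> h *\<^sub>R h + (\<Sum>h\<in>H - {g} - {h}. \<gamma> h *\<^sub>R h)"
        unfolding r_def using H h by (intro sum.remove) auto
      then have "- (\<gamma> h *\<^sub>R h) = (\<Sum>h\<in>H - {g} - {h}. \<gamma> h *\<^sub>R h)"
        using \<open>r = 0\<close> by (simp add: minus_unique)
      also have "\<dots> \<in> ?K"
        using partial[of "H - {g} - {h}" \<gamma>] mono[of "H - {g} - {h}"] H \<gamma>0 by auto
      finally have neg: "- (\<gamma> h *\<^sub>R h) \<in> ?K" .
      have "\<gamma> h *\<^sub>R h \<in> ?K"
        using h by (intro mul[OF hull_inc \<gamma>0]) auto
      then have "\<gamma> h *\<^sub>R h = 0"
        using neg by (rule pointed)
      then show ?thesis using \<open>h \<noteq> 0\<close> by simp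
    qed
    have "\<alpha> h = 0 \<and> \<beta> h = 0" if h: "h \<in> H - {g}" for h
    proof -
      have "0 \<le> (1 - t) * \<alpha> h" "0 \<le> t * \<beta> h"
        using \<alpha>(2)[of h] \<beta>(2)[of h] t h by auto
      then have "(1 - t) * \<alpha> h = 0" "t * \<beta> h = 0"
        using zero[OF h] unfolding \<gamma>_def by (simp_all only: add_nonneg_eq_0_iff)
      then show ?thesis using t by auto
    qed
    then have "a = \<alpha> g *\<^sub>R g" "b = \<beta> g *\<^sub>R g"
      unfolding \<alpha>(1) \<beta>(1) sum.remove[OF H g] by auto
    then show ?thesis using \<alpha>(2)[OF g] \<beta>(2)[OF g] by (auto simp: convex_cone_hull_singleton)
  qed
  show ?thesis
    unfolding cone_face_def face_of_def
    using mono[of "{g}"] g face convex_convex_cone_hull convex_cone_hull_nonempty by blast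
qed

text \<open>Choose \<open>w\<close> of least l1 norm among the vectors of which \<open>v\<close> is
  a positive multiple.\<close>

lemma primitive_multiple:
  fixes v :: "int ^ 'i::finite"
  assumes "v \<noteq> 0"
  obtains d w where "d > 0" "primitive w" "v = d *s w"
proof -
  define size where "size w = nat (\<Sum>i\<in>UNIV. \<bar>w $ i\<bar>)" for w :: "int ^ 'i"
  define P where "P w \<longleftrightarrow> (\<exists>d>0. v = d *s w)" for w
  have "P v" by (auto simp: P_def intro!: exI[of _ 1])
  then obtain w where w: "P w" and min: "\<And>w'. P w' \<Longrightarrow> size w \<le> size w'"
    using ex_has_least_nat[of P v size] by blast
  obtain d where d: "d > 0" "v = d *s w" using w by (auto simp: P_def)
  have "w \<noteq> 0" using assms d by auto
  moreover have "\<bar>m\<bar> = 1" if m: "w = m *s w'" for m w'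
  proof -
    have "m \<noteq> 0" using \<open>w \<noteq> 0\<close> m by auto
    \<comment> \<open>The factor \<open>m\<close> moves into the multiple and its sign stays on the
      vector. The norm of \<open>w\<close> is |m| times that of the new candidate, so minimality
      leaves only |m| = 1.\<close>
    have "v = (d * \<bar>m\<bar>) *s (sgn m *s w')"
      using d m by (simp add: vec_eq_iff abs_mult_sgn mult.assoc[symmetric])
    then have "P (sgn m *s w')"
      unfolding P_def using d \<open>m \<noteq> 0\<close> by (intro exI[of _ "d * \<bar>m\<bar>"]) auto
    then have "size w \<le> size (sgn m *s w')" by (rule min)
    moreover have "(\<Sum>i\<in>UNIV. \<bar>(sgn m *s w') $ i\<bar>) = (\<Sum>i\<in>UNIV. \<bar>w' $ i\<bar>)"
      using \<open>m \<noteq> 0\<close> by (simp add: abs_mult abs_sgn_eq)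
    moreover have "(\<Sum>i\<in>UNIV. \<bar>w $ i\<bar>) = \<bar>m\<bar> * (\<Sum>i\<in>UNIV. \<bar>w' $ i\<bar>)"
      by (simp add: m abs_mult sum_distrib_left)
    moreover have "(\<Sum>i\<in>UNIV. \<bar>w' $ i\<bar>) \<ge> 0" by (simp add: sum_nonneg)
    ultimately have "\<bar>m\<bar> * (\<Sum>i\<in>UNIV. \<bar>w' $ i\<bar>) \<le> 1 * (\<Sum>i\<in>UNIV. \<bar>w' $ i\<bar>)"
      by (simp add: size_def nat_le_iff)
    moreover have "(\<Sum>i\<in>UNIV. \<bar>w' $ i\<bar>) > 0"
    proof -
      obtain i where "w' $ i \<noteq> 0" using \<open>w \<noteq> 0\<close> m by (auto simp: vec_eq_iff)
      then show ?thesis by (intro sum_pos2[of _ i]) auto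
    qed
    ultimately have "\<bar>m\<bar> \<le> 1" by (simp add: mult_le_cancel_right)
    then show ?thesis using \<open>m \<noteq> 0\<close> by linarith
  qed
  ultimately have "primitive w" by (auto simp: primitive_def)
  with d show ?thesis using that by blast
qed

lemma pairing_scaleR: "pairing u (c *\<^sub>R x) = c * pairing u x"
  by (simp add: pairing_def sum_distrib_left mult_ac)

lemma pairing_sum_right: "pairing u (sum f A) = (\<Sum>x\<in>A. pairing u (f x))"
proof -
  have "pairing u (sum f A) = (\<Sum>i\<in>UNIV. \<Sum>x\<in>A. real_of_int (Poly_Mapping.lookup u i) * f x $ i)"
    by (simp add: pairing_def sum_distrib_left)
  also have "\<dots> = (\<Sum>x\<in>A. pairing u (f x))"
    unfolding pairing_def by (rule sum.swap)
  finally show ?thesis .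
qed

text \<open>An irredundant generating set of a strongly convex cone lies on its edges. These are
  faces, hence in the fan, and each is spanned by a primitive vector, so nonnegativity passes from
  the rays to the generators and to the whole cone.\<close>

lemma dual_monoid_if_nonneg_on_rays:
  assumes fan: "fan \<Sigma>" and \<sigma>: "\<sigma> \<in> \<Sigma>"
    and nonneg: "\<And>v. v \<in> ray_generators \<Sigma> \<Longrightarrow> real_vec v \<in> \<sigma> \<Longrightarrow> 0 \<le> pairing u (real_vec v)"
  shows "u \<in> dual_monoid \<sigma>"
proof -
  obtain G where G: "finite G" "\<sigma> = convex_cone hull (real_vec ` G)"
    using fan \<sigma> by (auto simp: fan_def rational_polyhedral_cone_def)
  obtain H where H: "H \<subseteq> real_vec ` G" "convex_cone hull H = \<sigma>"
    and min: "\<And>h. h \<in> H \<Longrightarrow> h \<notin> convex_cone hull (H - {h})"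
    using minimal_cone_generators[of "real_vec ` G"] G by auto
  have finH: "finite H" using H G finite_subset by blast
  have sc: "strongly_convex (convex_cone hull H)" using fan \<sigma> H by (auto simp: fan_def)
  have pos: "0 \<le> pairing u h" if h: "h \<in> H" for h
  proof -
    obtain v where v: "h = real_vec v" using h H by blast
    have "h \<noteq> 0" using min[OF h] convex_cone_hull_contains_0 by metis
    then have "v \<noteq> 0" by (auto simp: v real_vec_def vec_eq_iff)
    then obtain d w where w: "d > 0" "primitive w" "v = d *s w"
      by (rule primitive_multiple)
    have hw: "h = real_of_int d *\<^sub>R real_vec w"
      by (simp add: v w real_vec_def vec_eq_iff)
    then have wh: "real_vec w = (1 / real_of_int d) *\<^sub>R h"
      using w by simp
    have "convex_cone hull {real_vec w} = convex_cone hull {h}"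
    proof (intro subset_antisym hull_minimal convex_cone_convex_cone_hull; intro insert_subsetI empty_subsetI)
      show "real_vec w \<in> convex_cone hull {h}"
        unfolding wh using w by (intro convex_cone_hull_mul hull_inc) auto
      show "h \<in> convex_cone hull {real_vec w}"
        unfolding hw using w by (intro convex_cone_hull_mul hull_inc) auto
    qed
    moreover have "convex_cone hull {h} \<in> \<Sigma>"
      using minimal_generator_spans_face[OF finH sc min h] fan \<sigma> H by (auto simp: fan_def)
    ultimately have "w \<in> ray_generators \<Sigma>"
      using w by (simp add: ray_generators_def)
    moreover have "real_vec w \<in> \<sigma>"
      unfolding wh H(2)[symmetric] using w h by (intro convex_cone_hull_mul[OF hull_inc]) auto
    ultimately show ?thesis
      using nonneg[of w] w by (simp add: hw pairing_scaleR)
  qed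
  show ?thesis
    unfolding dual_monoid_def
  proof (intro CollectI ballI)
    fix x assume "x \<in> \<sigma>"
    then obtain c where "x = (\<Sum>h\<in>H. c h *\<^sub>R h)" "\<forall>h\<in>H. 0 \<le> c h"
      unfolding H(2)[symmetric] convex_cone_hull_finite[OF finH] by blast
    then show "0 \<le> pairing u x"
      using pos by (auto simp: pairing_sum_right pairing_scaleR intro!: sum_nonneg)
  qed
qed

section \<open>Representatives of \<open>M / qM\<close>\<close>

definition of_fun :: "('a::finite \<Rightarrow> int) \<Rightarrow> 'a \<Rightarrow>\<^sub>0 int" where
  "of_fun f = Abs_poly_mapping f"

lemma lookup_of_fun [simp]: "Poly_Mapping.lookup (of_fun f) i = f i"
  by (simp add: of_fun_def)

definition int_pairing :: "('i::finite \<Rightarrow>\<^sub>0 int) \<Rightarrow> int ^ 'i \<Rightarrow> int" where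
  "int_pairing u v = (\<Sum>i\<in>UNIV. Poly_Mapping.lookup u i * v $ i)"

lemma pairing_real_vec: "pairing u (real_vec v) = real_of_int (int_pairing u v)"
  by (simp add: pairing_def int_pairing_def real_vec_def)

lemma int_pairing_add_right: "int_pairing u (v + w) = int_pairing u v + int_pairing u w"
  by (simp add: int_pairing_def distrib_left sum.distrib)

lemma int_pairing_axis: "int_pairing u (axis i 1) = Poly_Mapping.lookup u i"
  by (simp add: int_pairing_def axis_def if_distrib[of "(*) _"] cong: if_cong)

text \<open>A choice of coordinates is only required to be additive, so linearity over the integers
  is derived here.\<close>

lemma int_additive_expansion:
  fixes F :: "int ^ 'i::finite \<Rightarrow> int"
  assumes add: "\<And>v w. F (v + w) = F v + F w"
  shows "F v = (\<Sum>i\<in>UNIV. v $ i * F (axis i 1))"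
proof -
  have zero: "F 0 = 0" using add[of 0 0] by simp
  have smult: "F (m *s x) = m * F x" for m x
  proof (induction m rule: int_induct[where k = 0])
    case base
    then show ?case by (simp add: zero)
  next
    case (step1 m)
    then show ?case by (simp add: vector_sadd_rdistrib add distrib_right)
  next
    case (step2 m)
    have "F (m *s x) = F ((m - 1) *s x) + F x"
      using add[of "(m - 1) *s x" x] by (simp add: vector_sub_rdistrib)
    then show ?case using step2 by (simp add: left_diff_distrib)
  qed
  have "F (\<Sum>i\<in>A. v $ i *s axis i 1) = (\<Sum>i\<in>A. v $ i * F (axis i 1))" if "finite A" for A
    using that by (induction A rule: finite_induct) (auto simp: zero add smult)
  from this[of UNIV] show ?thesis by (simp add: basis_expansion)
qed

text \<open>For odd positive \<open>q\<close> this is the residue of \<open>z\<close> between -(q -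
  1)/2 and (q - 1)/2: shift, reduce, shift back. The window is centred, which sends 0 to 0 and keeps
  absolute values as small as possible.\<close>

definition symmetric_residue :: "int \<Rightarrow> int \<Rightarrow> int" where
  "symmetric_residue q z = (z + (q - 1) div 2) mod q - (q - 1) div 2"

lemma symmetric_residue_dvd: "q dvd z - symmetric_residue q z"
proof -
  have *: "z - symmetric_residue q z = (z + (q - 1) div 2) - (z + (q - 1) div 2) mod q"
    by (simp add: symmetric_residue_def)
  show ?thesis unfolding * by (rule dvd_minus_mod)
qed

lemma symmetric_residue_cong: "q dvd z - z' \<Longrightarrow> symmetric_residue q z = symmetric_residue q z'"
  unfolding symmetric_residue_def by (metis mod_add_cong mod_eq_dvd_iff)

lemma symmetric_residue_zero: "q > 0 \<Longrightarrow> symmetric_residue q 0 = 0"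
  by (simp add: symmetric_residue_def)

lemma abs_symmetric_residue_le:
  assumes "odd q" "q > 0"
  shows "2 * \<bar>symmetric_residue q z\<bar> \<le> q - 1"
proof -
  define h m where "h = (q - 1) div 2" and "m = (z + h) mod q"
  have "2 * h = q - 1" "0 \<le> m" "m < q"
    using assms by (simp_all add: h_def m_def)
  then have "\<bar>m - h\<bar> \<le> h"
    by (intro abs_leI) linarith+
  then have "2 * \<bar>m - h\<bar> \<le> 2 * h"
    by simp
  also note \<open>2 * h = q - 1\<close>
  finally show ?thesis by (simp add: symmetric_residue_def h_def m_def)
qed

text \<open>Residues are taken in the coordinates on M dual to those given by \<open>\<phi>\<close>.
  There the pairing with \<open>v\<close> is a sum of column entries times residues, so column sum 2
  and residues at most (q - 1)/2 give at most q - 1. Dependence on the class alone is what later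
  yields semilinearity.\<close>

lemma binet_representatives:
  fixes S :: "(int ^ 'i::finite) set" and q :: nat
  assumes "binet S" and q: "odd q"
  obtains rep :: "('i \<Rightarrow>\<^sub>0 int) \<Rightarrow> ('i \<Rightarrow>\<^sub>0 int)" where
    "rep 0 = 0"
    "\<And>u i. int q dvd Poly_Mapping.lookup u i - Poly_Mapping.lookup (rep u) i"
    "\<And>u w. (\<And>i. int q dvd Poly_Mapping.lookup u i - Poly_Mapping.lookup w i) \<Longrightarrow> rep u = rep w"
    "\<And>u v. v \<in> S \<Longrightarrow> \<bar>int_pairing (rep u) v\<bar> < int q"
proof -
  obtain \<phi> :: "int ^ 'i \<Rightarrow> int ^ 'i" where bij: "bij \<phi>" and add: "\<And>v w. \<phi> (v + w) = \<phi> v + \<phi> w"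
    and S: "\<And>v. v \<in> S \<Longrightarrow> (\<Sum>r\<in>UNIV. \<bar>\<phi> v $ r\<bar>) \<le> 2"
    using assms(1) by (auto simp: binet_def binet_matrix_def)
  have q0: "int q > 0" using q by (simp add: odd_pos)
  define \<psi> where "\<psi> = inv_into UNIV \<phi>"
  have \<psi>: "\<psi> (\<phi> v) = v" "\<phi> (\<psi> v) = v" for v
    using bij by (simp_all add: \<psi>_def bij_is_inj bij_is_surj surj_f_inv_f)
  have \<psi>_add: "\<psi> (v + w) = \<psi> v + \<psi> w" for v w
    using add[of "\<psi> v" "\<psi> w"] by (metis \<psi>)
  \<comment> \<open>the coordinates of \<open>u\<close> dual to those given by \<open>\<phi>\<close>\<close>
  define co where "co u r = int_pairing u (\<psi> (axis r 1))" for u r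
  have co: "int_pairing u v = (\<Sum>r\<in>UNIV. \<phi> v $ r * co u r)" for u v
    using int_additive_expansion[of "\<lambda>x. int_pairing u (\<psi> x)" "\<phi> v"]
    by (simp add: \<psi> \<psi>_add int_pairing_add_right co_def)
  \<comment> \<open>The element of M whose dual coordinates are the residues, written back in
    standard coordinates.\<close>
  define rep where
    "rep u = of_fun (\<lambda>i. \<Sum>r\<in>UNIV. \<phi> (axis i 1) $ r * symmetric_residue (int q) (co u r))" for u
  have rep: "int_pairing (rep u) v = (\<Sum>r\<in>UNIV. \<phi> v $ r * symmetric_residue (int q) (co u r))" for u v
  proof -
    have "(\<Sum>r\<in>UNIV. \<phi> v $ r * symmetric_residue (int q) (co u r))
        = (\<Sum>i\<in>UNIV. v $ i * (\<Sum>r\<in>UNIV. \<phi> (axis i 1) $ r * symmetric_residue (int q) (co u r)))"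
      by (rule int_additive_expansion) (simp add: add distrib_right sum.distrib)
    then show ?thesis by (simp add: int_pairing_def rep_def mult.commute)
  qed
  show ?thesis
  proof (rule that[of rep])
    have "co 0 r = 0" for r by (simp add: co_def int_pairing_def)
    then show "rep 0 = 0"
      using symmetric_residue_zero[OF q0] by (intro poly_mapping_eqI) (simp add: rep_def)
    show "int q dvd Poly_Mapping.lookup u i - Poly_Mapping.lookup (rep u) i" for u i
      unfolding int_pairing_axis[symmetric] co[of u] rep sum_subtractf[symmetric] right_diff_distrib[symmetric]
      by (intro dvd_sum dvd_mult symmetric_residue_dvd)
    show "rep u = rep w"
      if uw: "\<And>i. int q dvd Poly_Mapping.lookup u i - Poly_Mapping.lookup w i" for u w
    proof -
      have "int q dvd co u r - co w r" for r
        unfolding co_def int_pairing_def sum_subtractf[symmetric] left_diff_distrib[symmetric]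
        by (intro dvd_sum dvd_mult2 uw)
      then have "symmetric_residue (int q) (co u r) = symmetric_residue (int q) (co w r)" for r
        by (rule symmetric_residue_cong)
      then show ?thesis by (simp add: rep_def)
    qed
    show "\<bar>int_pairing (rep u) v\<bar> < int q" if v: "v \<in> S" for u v
    proof -
      let ?s = "\<lambda>r. symmetric_residue (int q) (co u r)"
      have "2 * \<bar>int_pairing (rep u) v\<bar> \<le> (\<Sum>r\<in>UNIV. \<bar>\<phi> v $ r\<bar> * (2 * \<bar>?s r\<bar>))"
      proof -
        have "\<bar>int_pairing (rep u) v\<bar> \<le> (\<Sum>r\<in>UNIV. \<bar>\<phi> v $ r\<bar> * \<bar>?s r\<bar>)"
          using sum_abs[of "\<lambda>r. \<phi> v $ r * ?s r" UNIV] by (simp add: rep abs_mult)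
        moreover have "(\<Sum>r\<in>UNIV. \<bar>\<phi> v $ r\<bar> * (2 * \<bar>?s r\<bar>)) = 2 * (\<Sum>r\<in>UNIV. \<bar>\<phi> v $ r\<bar> * \<bar>?s r\<bar>)"
          by (simp add: sum_distrib_left mult.left_commute)
        ultimately show ?thesis by simp
      qed
      also have "\<dots> \<le> (\<Sum>r\<in>UNIV. \<bar>\<phi> v $ r\<bar> * (int q - 1))"
        using q q0 by (intro sum_mono mult_left_mono abs_symmetric_residue_le) auto
      also have "\<dots> = (\<Sum>r\<in>UNIV. \<bar>\<phi> v $ r\<bar>) * (int q - 1)"
        by (simp add: sum_distrib_right)
      also have "\<dots> \<le> 2 * (int q - 1)"
        using S[OF v] q0 by (intro mult_right_mono) auto
      finally show ?thesis by simp
    qed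
  qed
qed

section \<open>The diagonal splitting\<close>

text \<open>
  With \<open>a = rep u\<close>, the exponents \<open>((u - a) / q, (v + a) / q)\<close> that \<open>x\<^bsup>(u, v)\<^esup>\<close> is sent to;
  both are integral exactly when \<open>q\<close> divides \<open>u + v\<close>.
\<close>

definition split_exponent ::
    "nat \<Rightarrow> (('i::finite \<Rightarrow>\<^sub>0 int) \<Rightarrow> ('i \<Rightarrow>\<^sub>0 int)) \<Rightarrow> ('i + 'i \<Rightarrow>\<^sub>0 int) \<Rightarrow> ('i + 'i \<Rightarrow>\<^sub>0 int)" where
  "split_exponent q rep w = of_fun (\<lambda>k. case k of
     Inl i \<Rightarrow> (Poly_Mapping.lookup w (Inl i)
       - Poly_Mapping.lookup (rep (Poly_Mapping.map_key Inl w)) i) div int q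
   | Inr i \<Rightarrow> (Poly_Mapping.lookup w (Inr i)
       + Poly_Mapping.lookup (rep (Poly_Mapping.map_key Inl w)) i) div int q)"

definition split_monomial ::
    "nat \<Rightarrow> (('i::{finite,linorder} \<Rightarrow>\<^sub>0 int) \<Rightarrow> ('i \<Rightarrow>\<^sub>0 int))
      \<Rightarrow> ('i + 'i \<Rightarrow>\<^sub>0 int) \<Rightarrow> ('i + 'i, 'k::field) laurent" where
  "split_monomial q rep w = (if \<forall>i. int q dvd Poly_Mapping.lookup (codiagonal w) i
     then Poly_Mapping.single (split_exponent q rep w) 1 else 0)"

text \<open>On a ray \<open>v\<close> of the cone, q <w, v> = <u, v> + <a, v> exceeds -q because <u,
  v> is nonnegative. So the integer <w, v> exceeds -1 and is at least 0. The two-sided bound admits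
  both signs of the shift, as the two factors of the product require.\<close>

lemma dual_monoid_div:
  assumes fan: "fan \<Sigma>" "\<sigma> \<in> \<Sigma>" and "q > 0" and u: "u \<in> dual_monoid \<sigma>" and w: "scale q w = u + a"
    and a: "\<And>v. v \<in> ray_generators \<Sigma> \<Longrightarrow> \<bar>int_pairing a v\<bar> < int q"
  shows "w \<in> dual_monoid \<sigma>"
proof (rule dual_monoid_if_nonneg_on_rays[OF fan])
  fix v assume v: "v \<in> ray_generators \<Sigma>" "real_vec v \<in> \<sigma>"
  have "real q * pairing w (real_vec v) = pairing u (real_vec v) + pairing a (real_vec v)"
    by (simp add: pairing_scale[symmetric] w pairing_add)
  moreover have "pairing u (real_vec v) \<ge> 0"
    using u v by (simp add: dual_monoid_def)
  ultimately have "real q * pairing w (real_vec v) > - real q"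
    using a[OF v(1)] by (simp add: pairing_real_vec)
  then have "real_of_int (int q * int_pairing w v) > real_of_int (int q * (- 1))"
    by (simp add: pairing_real_vec)
  then have "int q * int_pairing w v > int q * (- 1)"
    by (simp only: of_int_less_iff)
  then have "int_pairing w v > - 1"
    using assms(3) by (simp only: mult_less_cancel_left_pos of_nat_0_less_iff)
  then show "0 \<le> pairing w (real_vec v)" by (simp add: pairing_real_vec)
qed

locale diagonal_splitting_data =
  fixes \<Sigma> :: "(real ^ 'i::{finite,linorder}) set set" and q :: nat
    and rep :: "('i \<Rightarrow>\<^sub>0 int) \<Rightarrow> ('i \<Rightarrow>\<^sub>0 int)"
  assumes fan: "fan \<Sigma>" and q: "q > 0"
    and rep_zero: "rep 0 = 0"
    and rep_dvd: "\<And>u i. int q dvd Poly_Mapping.lookup u i - Poly_Mapping.lookup (rep u) i"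
    and rep_cong: "\<And>u w. (\<And>i. int q dvd Poly_Mapping.lookup u i - Poly_Mapping.lookup w i) \<Longrightarrow> rep u = rep w"
    and rep_bound: "\<And>u v. v \<in> ray_generators \<Sigma> \<Longrightarrow> \<bar>int_pairing (rep u) v\<bar> < int q"
begin

abbreviation split_map :: "('i + 'i \<Rightarrow>\<^sub>0 int) \<Rightarrow> ('i + 'i, 'k::field) laurent" where
  "split_map \<equiv> split_monomial q rep"

lemma rep_dvd_left:
  "int q dvd Poly_Mapping.lookup w (Inl i) - Poly_Mapping.lookup (rep (Poly_Mapping.map_key Inl w)) i"
  using rep_dvd[of "Poly_Mapping.map_key Inl w" i] by (simp add: lookup_map_key)

lemma rep_dvd_right:
  assumes "int q dvd Poly_Mapping.lookup (codiagonal w) i"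
  shows "int q dvd Poly_Mapping.lookup w (Inr i) + Poly_Mapping.lookup (rep (Poly_Mapping.map_key Inl w)) i"
proof -
  have "int q dvd Poly_Mapping.lookup (codiagonal w) i
      - (Poly_Mapping.lookup w (Inl i) - Poly_Mapping.lookup (rep (Poly_Mapping.map_key Inl w)) i)"
    by (rule dvd_diff[OF assms rep_dvd_left])
  then show ?thesis by (simp add: lookup_codiagonal algebra_simps)
qed

text \<open>Adding \<open>scale q u\<close> leaves the class of the first component modulo q
  unchanged, hence also the shift taken from \<open>rep\<close>, so the exponent just moves by
  \<open>u\<close>. \<open>rep_zero\<close> is what sends 1 to 1.\<close>

lemma equivariant: "frob_equivariant q (split_map :: _ \<Rightarrow> ('i + 'i, 'k::field) laurent)"
  unfolding frob_equivariant_def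
proof (intro conjI allI)
  have "split_exponent q rep 0 = 0"
    by (rule poly_mapping_eqI) (simp add: split_exponent_def rep_zero split: sum.split)
  then show "split_map 0 = (1 :: ('i + 'i, 'k) laurent)"
    by (simp add: split_monomial_def codiagonal_zero)
  fix u w :: "'i + 'i \<Rightarrow>\<^sub>0 int"
  have rep: "rep (Poly_Mapping.map_key Inl (scale q u + w)) = rep (Poly_Mapping.map_key Inl w)"
    by (rule rep_cong) (simp add: lookup_map_key lookup_add)
  have "(int q * m + n - b) div int q = m + (n - b) div int q"
    "(int q * m + n + b) div int q = m + (n + b) div int q" for m n b
    using q by (simp_all add: add_diff_eq[symmetric] add.assoc)
  then have "split_exponent q rep (scale q u + w) = u + split_exponent q rep w"
    by (intro poly_mapping_eqI) (simp add: split_exponent_def lookup_add rep split: sum.split)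
  moreover have "int q dvd int q * m + n \<longleftrightarrow> int q dvd n" for m n
    by (simp add: dvd_add_right_iff)
  ultimately show "split_map (scale q u + w) = Poly_Mapping.single u 1 * (split_map w :: ('i + 'i, 'k) laurent)"
    by (simp add: split_monomial_def codiagonal_add codiagonal_scale lookup_add mult_single)
qed

text \<open>The opposite shifts cancel in the sum of the two exponents, which leaves (u + v)/q
  whatever \<open>rep\<close> is.\<close>

lemma comult_split_map: "comult (split_map w :: ('i + 'i, 'k::field) laurent) = exact_root q (codiagonal w)"
proof (cases "\<forall>i. int q dvd Poly_Mapping.lookup (codiagonal w) i")
  case True
  have "codiagonal (split_exponent q rep w) = Poly_Mapping.map (\<lambda>m. m div int q) (codiagonal w)"
  proof (rule poly_mapping_eqI)
    fix i
    let ?a = "Poly_Mapping.lookup (rep (Poly_Mapping.map_key Inl w)) i"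
    \<comment> \<open>Rounded quotients add here because the first division is exact.\<close>
    have "(Poly_Mapping.lookup w (Inl i) - ?a) div int q + (Poly_Mapping.lookup w (Inr i) + ?a) div int q
        = (Poly_Mapping.lookup w (Inl i) - ?a + (Poly_Mapping.lookup w (Inr i) + ?a)) div int q"
      by (rule div_plus_div_distrib_dvd_left[OF rep_dvd_left, symmetric])
    then show "Poly_Mapping.lookup (codiagonal (split_exponent q rep w)) i
        = Poly_Mapping.lookup (Poly_Mapping.map (\<lambda>m. m div int q) (codiagonal w)) i"
      by (simp add: lookup_codiagonal split_exponent_def)
  qed
  with True show ?thesis
    by (simp add: split_monomial_def exact_root_def)
next
  case False
  then show ?thesis
    by (auto simp: split_monomial_def exact_root_def monomial_map_lin_ext)
qed

text \<open>In the nonzero case both quotients are exact, so \<open>dual_monoid_div\<close> applies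
  to the first component with the shift \<open>- rep\<close> and to the second with
  \<open>rep\<close>.\<close>

lemma split_map_coord_ring:
  assumes "\<rho> \<in> product_fan \<Sigma> \<Sigma>" and w: "w \<in> dual_monoid \<rho>"
  shows "split_map w \<in> (coord_ring \<rho> :: ('i + 'i, 'k::field) laurent set)"
proof (cases "\<forall>i. int q dvd Poly_Mapping.lookup (codiagonal w) i")
  case True
  obtain \<sigma> \<tau> where \<rho>: "\<rho> = product_cone \<sigma> \<tau>" "\<sigma> \<in> \<Sigma>" "\<tau> \<in> \<Sigma>"
    using assms(1) by (auto simp: product_fan_def)
  have zero: "0 \<in> \<sigma>" "0 \<in> \<tau>"
    using fan \<rho> by (auto simp: fan_def strongly_convex_def)
  let ?w1 = "Poly_Mapping.map_key Inl w" and ?w2 = "Poly_Mapping.map_key Inr w"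
  let ?e = "split_exponent q rep w"
  have w12: "?w1 \<in> dual_monoid \<sigma>" "?w2 \<in> dual_monoid \<tau>"
    using w unfolding \<rho>(1) dual_monoid_product_cone[OF zero] by auto
  have "scale q (Poly_Mapping.map_key Inl ?e) = ?w1 + - rep ?w1"
    by (intro poly_mapping_eqI)
      (simp add: lookup_map_key lookup_minus split_exponent_def dvd_mult_div_cancel[OF rep_dvd_left])
  then have "Poly_Mapping.map_key Inl ?e \<in> dual_monoid \<sigma>"
    by (rule dual_monoid_div[OF fan \<rho>(2) q w12(1)])
      (use rep_bound in \<open>auto simp: int_pairing_def sum_negf\<close>)
  moreover have "scale q (Poly_Mapping.map_key Inr ?e) = ?w2 + rep ?w1"
    using rep_dvd_right[OF True[rule_format]] by (intro poly_mapping_eqI)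
      (simp add: lookup_map_key lookup_add split_exponent_def)
  then have "Poly_Mapping.map_key Inr ?e \<in> dual_monoid \<tau>"
    by (rule dual_monoid_div[OF fan \<rho>(3) q w12(2)]) (rule rep_bound)
  ultimately have "?e \<in> dual_monoid \<rho>"
    unfolding \<rho>(1) dual_monoid_product_cone[OF zero] by simp
  then show ?thesis
    using True by (simp add: split_monomial_def single_in_coord_ring)
next
  case False
  then have "split_map w = (0 :: ('i + 'i, 'k) laurent)"
    by (auto simp: split_monomial_def)
  then show ?thesis by (simp add: coord_ringD(2))
qed

lemma diagonally_split: "diagonally_split TYPE('k::field) \<Sigma> q"
  unfolding diagonally_split_def
  using splitting_frac_ext[OF q equivariant split_map_coord_ring]
    compatible_with_diagonal[OF q equivariant split_map_coord_ring comult_split_map]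
  by blast

end

theorem proposition6p2:
  fixes \<Sigma> :: "(real ^ 'i::{finite,linorder}) set set"
  assumes "complete_fan \<Sigma>"
    and "binet (ray_generators \<Sigma>)"
  shows "\<forall>q::nat. odd q \<and> q \<ge> 3 \<longrightarrow> diagonally_split TYPE('k::field) \<Sigma> q"
proof (intro allI impI)
  fix q :: nat
  assume q: "odd q \<and> q \<ge> 3"
  then have "odd q" by simp
  obtain rep :: "('i \<Rightarrow>\<^sub>0 int) \<Rightarrow> ('i \<Rightarrow>\<^sub>0 int)" where rep:
    "rep 0 = 0"
    "\<And>u i. int q dvd Poly_Mapping.lookup u i - Poly_Mapping.lookup (rep u) i"
    "\<And>u w. (\<And>i. int q dvd Poly_Mapping.lookup u i - Poly_Mapping.lookup w i) \<Longrightarrow> rep u = rep w"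
    "\<And>u v. v \<in> ray_generators \<Sigma> \<Longrightarrow> \<bar>int_pairing (rep u) v\<bar> < int q"
    using binet_representatives[OF assms(2) \<open>odd q\<close>] by metis
  interpret diagonal_splitting_data \<Sigma> q rep
    using assms(1) q rep by unfold_locales (auto simp: complete_fan_def)
  show "diagonally_split TYPE('k) \<Sigma> q"
    by (rule diagonally_split)
qed

end
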